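(* There is a universal constant $c>0$ such that for every $n$ and every nontrivial monotone graph property $f:\{0,1\}^{\binom{n}{2}}\to\{0,1\}$, we have $\mathrm{Q}(f)\ge c\,n$.
   Context: The input $x\in\{0,1\}^{\binom n2}$ is viewed as the adjacency matrix of an undirected simple graph on vertex set $[n]$: the coordinate indexed by the unordered pair $\{i,j\}$ indicates whether $\{i,j\}$ is an edge. $f$ is a graph property if $f$ is invariant under every relabeling of the vertices (permutation of $[n]$ acting on pairs). $f$ is monotone if $x\le y$ coordinatewise implies $f(x)\le f(y)$. $f$ is nontrivial if it is not constant. $\mathrm{Q}(f)$ is the bounded-error quantum query complexity: the minimum number of queries of a quantum query algorithm that outputs $f(x)$ with probability at least $2/3$ on every input. *)

theory Defs
  imports Complex_Main "HOL-Library.FuncSet" "HOL-Combinatorics.Permutations"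
begin

text \<open>Inputs are functions x on a finite index set I (extensional functions on I).
 The Hilbert space has orthonormal basis I \<times> bool \<times> {..<W}: query register, answer bit,
 workspace. States are functions basis \<Rightarrow> complex, supported on the basis set.\<close>

definition qbasis :: "'i set \<Rightarrow> nat \<Rightarrow> ('i \<times> bool \<times> nat) set" where
  "qbasis I W = I \<times> (UNIV :: bool set) \<times> {..<W}"

type_synonym 'i qmat = "('i \<times> bool \<times> nat) \<Rightarrow> ('i \<times> bool \<times> nat) \<Rightarrow> complex"
type_synonym 'i qstate = "('i \<times> bool \<times> nat) \<Rightarrow> complex"

definition unitary_on :: "('i \<times> bool \<times> nat) set \<Rightarrow> 'i qmat \<Rightarrow> bool" where
  "unitary_on B U \<longleftrightarrow>
     (\<forall>j\<in>B. \<forall>j'\<in>B. (\<Sum>k\<in>B. cnj (U k j) * U k j') = (if j = j' then 1 else 0))"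

definition apply_mat :: "('i \<times> bool \<times> nat) set \<Rightarrow> 'i qmat \<Rightarrow> 'i qstate \<Rightarrow> 'i qstate" where
  "apply_mat B U v = (\<lambda>k. if k \<in> B then (\<Sum>j\<in>B. U k j * v j) else 0)"

text \<open>Standard query operator: |i,b,w> \<mapsto> |i, b xor x_i, w>.\<close>
definition query_op :: "('i \<Rightarrow> bool) \<Rightarrow> 'i qstate \<Rightarrow> 'i qstate" where
  "query_op x v = (\<lambda>(i, b, w). v (i, b \<noteq> x i, w))"

definition basis_vec :: "('i \<times> bool \<times> nat) \<Rightarrow> 'i qstate" where
  "basis_vec s = (\<lambda>k. if k = s then 1 else 0)"

fun qrun :: "('i \<times> bool \<times> nat) set \<Rightarrow> ('i \<Rightarrow> bool) \<Rightarrow> 'i qstate \<Rightarrow> 'i qmat list \<Rightarrow> 'i qstate" where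
  "qrun B x \<psi> [] = \<psi>"
| "qrun B x \<psi> (U # Us) = qrun B x (apply_mat B U (query_op x \<psi>)) Us"

definition final_state ::
  "('i \<times> bool \<times> nat) set \<Rightarrow> ('i \<Rightarrow> bool) \<Rightarrow> ('i \<times> bool \<times> nat) \<Rightarrow> 'i qmat \<Rightarrow> 'i qmat list \<Rightarrow> 'i qstate" where
  "final_state B x s0 U0 Us = qrun B x (apply_mat B U0 (basis_vec s0)) Us"

text \<open>A T-query algorithm computing f with bounded error 1/3: the final state is measured
 in the computational basis and an output bit is computed from the outcome.\<close>
definition computes_bounded_error :: "'i set \<Rightarrow> (('i \<Rightarrow> bool) \<Rightarrow> bool) \<Rightarrow> nat \<Rightarrow> bool" where
  "computes_bounded_error I f T \<longleftrightarrow>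
     (\<exists>W s0 U0 Us out.
        s0 \<in> qbasis I W \<and> unitary_on (qbasis I W) U0 \<and>
        (\<forall>U\<in>set Us. unitary_on (qbasis I W) U) \<and> length Us = T \<and>
        (\<forall>x \<in> I \<rightarrow>\<^sub>E (UNIV :: bool set).
           (\<Sum>k\<in>{k \<in> qbasis I W. out k = f x}.
              (cmod (final_state (qbasis I W) x s0 U0 Us k))\<^sup>2) \<ge> 2/3))"

definition Q :: "'i set \<Rightarrow> (('i \<Rightarrow> bool) \<Rightarrow> bool) \<Rightarrow> nat" where
  "Q I f = (LEAST T. computes_bounded_error I f T)"

definition graph_edges :: "nat \<Rightarrow> nat set set" where
  "graph_edges n = {e. e \<subseteq> {..<n} \<and> card e = 2}"

abbreviation graph_inputs :: "nat \<Rightarrow> (nat set \<Rightarrow> bool) set" where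
  "graph_inputs n \<equiv> graph_edges n \<rightarrow>\<^sub>E (UNIV :: bool set)"

definition is_graph_property :: "nat \<Rightarrow> ((nat set \<Rightarrow> bool) \<Rightarrow> bool) \<Rightarrow> bool" where
  "is_graph_property n f \<longleftrightarrow>
     (\<forall>\<pi>. \<pi> permutes {..<n} \<longrightarrow>
        (\<forall>x \<in> graph_inputs n. f (restrict (\<lambda>e. x (\<pi> ` e)) (graph_edges n)) = f x))"

definition monotone_on_inputs :: "nat \<Rightarrow> ((nat set \<Rightarrow> bool) \<Rightarrow> bool) \<Rightarrow> bool" where
  "monotone_on_inputs n f \<longleftrightarrow>
     (\<forall>x \<in> graph_inputs n. \<forall>y \<in> graph_inputs n.
        (\<forall>e \<in> graph_edges n. x e \<longrightarrow> y e) \<longrightarrow> f x \<longrightarrow> f y)"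

definition nontrivial_on_inputs :: "nat \<Rightarrow> ((nat set \<Rightarrow> bool) \<Rightarrow> bool) \<Rightarrow> bool" where
  "nontrivial_on_inputs n f \<longleftrightarrow> (\<exists>x \<in> graph_inputs n. \<exists>y \<in> graph_inputs n. f x \<noteq> f y)"

end

theory Submission
  imports Defs
begin

text \<open>
  Fix \<open>m = 2 ^ k\<close> with \<open>2 m \<le> n < 4 m\<close>. By the argument of Rivest and Vuillemin, some restriction of
  \<open>f\<close> leaves free exactly the edges between two disjoint sets of \<open>m\<close> vertices, is invariant under a
  group acting transitively on these \<open>m\<^sup>2\<close> edges, and differs at the two extreme points. As \<open>m\<^sup>2\<close> is a
  power of two, such a function has an odd number of ones, so it has full degree, and one of the two
  sets on which \<open>f\<close> agrees or disagrees with parity contains more than half of the \<open>m\<^sup>2\<close>-cube. Huang's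
  signed adjacency matrix then yields a nonnegative vector on this set which witnesses spectral
  sensitivity at least \<open>sqrt (m\<^sup>2) = m\<close>. The positive-weight adversary method, with this vector as
  weights, shows that every bounded-error algorithm makes at least \<open>m / 36\<close> queries.
\<close>

section \<open>Huang's theorem\<close>

text \<open>Counting orbits of a transitive group modulo a prime needs a prime power number of
  variables, which \<open>n * (n - 1) / 2\<close> rarely is. This forces the passage to a complete
  bipartite graph with both sides a power of two. It costs only a constant factor:
  \<open>n < 4 * m\<close> leaves more than \<open>n\<^sup>2 / 16\<close> free variables, and the
  square root lost in Huang's bound makes this linear in \<open>n\<close>. The adversary argument
  needs weights that vanish on pairs with equal value of \<open>f\<close>; a vector supported on a
  set all of whose internal cube edges are sensitive provides them. A query lowers the weighted
  progress by at most twice the squared norm of this vector, while correctness demands the loss of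
  1/18 of the initial value; thus \<open>36 = 2 * 18\<close>.\<close>

definition toggle :: "'a \<Rightarrow> 'a set \<Rightarrow> 'a set" where
  "toggle i S = (if i \<in> S then S - {i} else insert i S)"

lemma toggle_toggle [simp]: "toggle i (toggle i S) = S"
  by (auto simp: toggle_def)

lemma toggle_commute: "toggle i (toggle j S) = toggle j (toggle i S)"
  by (auto simp: toggle_def)

lemma toggle_subset: "i \<in> E \<Longrightarrow> S \<subseteq> E \<Longrightarrow> toggle i S \<subseteq> E"
  by (auto simp: toggle_def)

lemma in_toggle_iff: "j \<in> toggle i S \<longleftrightarrow> (if j = i then i \<notin> S else j \<in> S)"
  by (auto simp: toggle_def)

lemma even_card_toggle: "finite S \<Longrightarrow> even (card (toggle i S)) \<longleftrightarrow> odd (card S)"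
  by (auto simp: toggle_def card_Diff_singleton card_gt_0_iff)

lemma sum_Pow_toggle:
  assumes "i \<in> E"
  shows "(\<Sum>S\<in>Pow E. h (toggle i S)) = (\<Sum>S\<in>Pow E. h S)"
  by (rule sum.reindex_bij_witness[where i = "toggle i" and j = "toggle i"])
    (use assms in \<open>auto simp: toggle_def\<close>)

text \<open>The sign is chosen so that signed toggles of distinct coordinates anticommute.\<close>
definition toggle_sign :: "('a \<Rightarrow> nat) \<Rightarrow> 'a \<Rightarrow> 'a set \<Rightarrow> real" where
  "toggle_sign r i S = (-1) ^ card {j \<in> S. r j < r i}"

definition signed_adj :: "'a set \<Rightarrow> ('a \<Rightarrow> nat) \<Rightarrow> ('a set \<Rightarrow> real) \<Rightarrow> 'a set \<Rightarrow> real" where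
  "signed_adj E r u S = (\<Sum>i\<in>E. toggle_sign r i S * u (toggle i S))"

lemma toggle_sign_square: "toggle_sign r i S * toggle_sign r i S = 1"
  by (simp add: toggle_sign_def flip: power_mult_distrib)

lemma abs_toggle_sign: "\<bar>toggle_sign r i S\<bar> = 1"
  by (simp add: toggle_sign_def)

text \<open>The count in the exponent for \<open>j\<close> changes by one exactly when
  \<open>i\<close> precedes \<open>j\<close> in the order given by \<open>r\<close>.\<close>

lemma toggle_sign_toggle:
  assumes "finite S"
  shows "toggle_sign r j (toggle i S) = (if r i < r j then - toggle_sign r j S else toggle_sign r j S)"
proof (cases "r i < r j")
  case True
  have "{k \<in> toggle i S. r k < r j} = toggle i {k \<in> S. r k < r j}"
    using True by (auto simp: toggle_def)
  then show ?thesis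
    using True even_card_toggle[of "{k \<in> S. r k < r j}" i] assms
    by (simp add: toggle_sign_def minus_one_power_iff)
next
  case False
  then have "{k \<in> toggle i S. r k < r j} = {k \<in> S. r k < r j}"
    by (auto simp: toggle_def)
  then show ?thesis
    using False by (simp add: toggle_sign_def)
qed

text \<open>For distinct \<open>i\<close> and \<open>j\<close> the terms \<open>t i j\<close> and
  \<open>t j i\<close> reach the same doubly toggled set, and exactly one of the two toggles flips
  the sign of the other, so they cancel. Only the \<open>card E\<close> diagonal terms
  survive.\<close>

lemma signed_adj_square:
  assumes "finite E" "inj_on r E" "S \<subseteq> E"
  shows "signed_adj E r (signed_adj E r u) S = real (card E) * u S"
proof -
  have finS: "finite S"
    using assms finite_subset by blast
  define t where "t i j = toggle_sign r i S * (toggle_sign r j (toggle i S) * u (toggle j (toggle i S)))" for i j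
  define t' where "t' i j = (if i = j then 0 else t i j)" for i j
  have anti: "t' i j = - t' j i" if "i \<in> E" "j \<in> E" for i j
  proof (cases "i = j")
    case False
    then have "r i \<noteq> r j"
      using assms that by (auto dest: inj_onD)
    then show ?thesis
      using False toggle_commute[of i j S]
      by (auto simp: t'_def t_def toggle_sign_toggle[OF finS])
  qed (simp add: t'_def)
  have "(\<Sum>i\<in>E. \<Sum>j\<in>E. t' i j) = (\<Sum>j\<in>E. \<Sum>i\<in>E. t' i j)"
    by (rule sum.swap)
  also have "\<dots> = (\<Sum>j\<in>E. \<Sum>i\<in>E. - t' j i)"
    by (intro sum.cong refl anti)
  finally have zero: "(\<Sum>i\<in>E. \<Sum>j\<in>E. t' i j) = 0"
    by (simp add: sum_negf)
  have diag: "t i i = u S" for i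
    by (simp add: t_def toggle_sign_toggle[OF finS] toggle_sign_square flip: mult.assoc)
  have "signed_adj E r (signed_adj E r u) S = (\<Sum>i\<in>E. \<Sum>j\<in>E. t i j)"
    by (simp add: signed_adj_def t_def sum_distrib_left)
  also have "\<dots> = (\<Sum>i\<in>E. \<Sum>j\<in>E. t' i j + (if i = j then u S else 0))"
    by (intro sum.cong refl) (auto simp: t'_def diag)
  also have "\<dots> = real (card E) * u S"
    using assms(1) by (simp add: sum.distrib zero)
  finally show ?thesis .
qed

text \<open>Gaussian elimination, one equation at a time. This dimension count takes the place of
  eigenvalue interlacing in Huang's argument.\<close>

lemma underdetermined_system_nontrivial_solution:
  fixes M :: "'c \<Rightarrow> 'x \<Rightarrow> real"
  assumes "finite C" "finite X" "card C < card X"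
  shows "\<exists>w. (\<exists>x\<in>X. w x \<noteq> 0) \<and> (\<forall>c\<in>C. (\<Sum>x\<in>X. M c x * w x) = 0)"
  using assms
proof (induction C arbitrary: X M rule: finite_induct)
  case empty
  then obtain p where "p \<in> X"
    by (metis card.empty less_irrefl equals0I)
  then show ?case
    by (intro exI[of _ "\<lambda>_. 1"]) auto
next
  case (insert c C)
  show ?case
  proof (cases "\<forall>x\<in>X. M c x = 0")
    case True
    obtain w where "\<exists>x\<in>X. w x \<noteq> 0" "\<forall>c\<in>C. (\<Sum>x\<in>X. M c x * w x) = 0"
      using insert.IH[of X M] insert.prems insert.hyps by auto
    with True show ?thesis
      by (intro exI[of _ w]) auto
  next
    case False
    then obtain p where p: "p \<in> X" "M c p \<noteq> 0"
      by blast
    define X' where "X' = X - {p}"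
    \<comment> \<open>Subtracting a multiple of row \<open>c\<close> clears the column of the pivot
      \<open>p\<close>.\<close>
    define M' where "M' c' x = M c' x - M c' p / M c p * M c x" for c' x
    have "finite X'" "card C < card X'"
      using insert.prems insert.hyps p by (auto simp: X'_def)
    then obtain w where w: "\<exists>x\<in>X'. w x \<noteq> 0" "\<forall>c\<in>C. (\<Sum>x\<in>X'. M' c x * w x) = 0"
      using insert.IH[of X' M'] by blast
    \<comment> \<open>The value at \<open>p\<close> solves equation \<open>c\<close>; the remaining
      equations then become those of \<open>M'\<close>.\<close>
    define z where "z = w(p := - (\<Sum>x\<in>X'. M c x * w x) / M c p)"
    have sum_z: "(\<Sum>x\<in>X. M c' x * z x) = M c' p * z p + (\<Sum>x\<in>X'. M c' x * w x)" for c'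
    proof -
      have "(\<Sum>x\<in>X. M c' x * z x) = M c' p * z p + (\<Sum>x\<in>X'. M c' x * z x)"
        using p insert.prems by (simp add: X'_def sum.remove)
      also have "(\<Sum>x\<in>X'. M c' x * z x) = (\<Sum>x\<in>X'. M c' x * w x)"
        by (intro sum.cong refl) (auto simp: z_def X'_def)
      finally show ?thesis .
    qed
    have "(\<Sum>x\<in>X. M c' x * z x) = 0" if "c' \<in> C" for c'
    proof -
      have "0 = (\<Sum>x\<in>X'. M' c' x * w x)"
        using w that by simp
      also have "\<dots> = (\<Sum>x\<in>X'. M c' x * w x) - M c' p / M c p * (\<Sum>x\<in>X'. M c x * w x)"
        by (simp add: M'_def left_diff_distrib sum_subtractf sum_distrib_left mult.assoc)
      finally show ?thesis
        unfolding sum_z by (simp add: z_def)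
    qed
    moreover have "(\<Sum>x\<in>X. M c x * z x) = 0"
      unfolding sum_z using p by (simp add: z_def)
    moreover have "\<exists>x\<in>X. z x \<noteq> 0"
      using w(1) by (auto simp: z_def X'_def)
    ultimately show ?thesis
      by (intro exI[of _ z]) auto
  qed
qed

lemma signed_adj_linear:
  "signed_adj E r (\<lambda>S. a * u S + b * w S) S = a * signed_adj E r u S + b * signed_adj E r w S"
  by (simp add: signed_adj_def algebra_simps sum.distrib sum_distrib_left)

text \<open>If \<open>A\<^sup>2 = d\<close> then \<open>A w + sqrt d * w\<close> is always an eigenvector of \<open>A\<close>; taking \<open>w\<close> supported on half of
  the cube leaves enough freedom to make it vanish outside \<open>H\<close>.\<close>
lemma huang_eigenvector:
  assumes fin: "finite E" and ne: "E \<noteq> {}" and H: "H \<subseteq> Pow E" "2 ^ card E < 2 * card H"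
  obtains v :: "'a set \<Rightarrow> real" where "\<And>S. v S \<ge> 0" "\<And>S. S \<notin> H \<Longrightarrow> v S = 0"
    "(\<Sum>S\<in>Pow E. (v S)\<^sup>2) > 0"
    "sqrt (card E) * (\<Sum>S\<in>Pow E. (v S)\<^sup>2) \<le> (\<Sum>S\<in>Pow E. \<Sum>i\<in>E. v S * v (toggle i S))"
proof -
  obtain r :: "'a \<Rightarrow> nat" where r: "inj_on r E"
    using finite_imp_inj_to_nat_seg fin by metis
  obtain e where e: "e \<in> E"
    using ne by blast
  define d where "d = sqrt (card E)"
  \<comment> \<open>\<open>X\<close> supplies \<open>2 ^ (card E - 1)\<close> unknowns. Vanishing of
    \<open>u\<close> on \<open>C\<close> imposes fewer equations, since \<open>H\<close> is more
    than half of the cube. \<open>M\<close> is the matrix of \<open>signed_adj E r\<close> plus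
    \<open>d\<close> times the identity.\<close>
  define X where "X = Pow (E - {e})"
  define C where "C = Pow E - H"
  define M where "M S R = (\<Sum>i\<in>E. if toggle i S = R then toggle_sign r i S else 0)
      + (if S = R then d else 0)" for S R
  have finX: "finite X" and finC: "finite C"
    using fin by (auto simp: X_def C_def)
  have "card X = 2 ^ (card E - 1)"
    using fin e by (simp add: X_def card_Pow)
  then have "2 * card X = 2 ^ card E"
    using fin e by (metis card_gt_0_iff empty_iff power_eq_if less_irrefl)
  moreover have "card C + card H = 2 ^ card E"
    using fin H(1) unfolding C_def
    by (metis card_Diff_subset card_Pow card_mono finite_Pow_iff finite_subset le_add_diff_inverse2)
  ultimately have "card C < card X"
    using H(2) by linarith
  then obtain w0 where w0: "\<exists>R\<in>X. w0 R \<noteq> 0" "\<forall>S\<in>C. (\<Sum>R\<in>X. M S R * w0 R) = 0"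
    using underdetermined_system_nontrivial_solution[OF finC finX, of M] by blast
  define w where "w R = (if R \<in> X then w0 R else 0)" for R
  define u where "u S = signed_adj E r w S + d * w S" for S
  have u_eq: "u S = (\<Sum>R\<in>X. M S R * w0 R)" for S
  proof -
    have "(\<Sum>R\<in>X. M S R * w0 R) = (\<Sum>i\<in>E. \<Sum>R\<in>X. (if toggle i S = R then toggle_sign r i S else 0) * w0 R)
       + (\<Sum>R\<in>X. (if S = R then d else 0) * w0 R)"
      unfolding M_def distrib_right sum.distrib sum_distrib_right by (subst sum.swap) simp
    also have "\<dots> = u S"
      using finX by (simp add: u_def signed_adj_def w_def if_distribR if_distrib cong: if_cong)
    finally show ?thesis ..
  qed
  have eigen: "signed_adj E r u S = d * u S" if "S \<subseteq> E" for S
  proof -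
    have "signed_adj E r u S = signed_adj E r (\<lambda>S. 1 * signed_adj E r w S + d * w S) S"
      by (simp add: u_def[abs_def])
    also have "\<dots> = d\<^sup>2 * w S + d * signed_adj E r w S"
      unfolding signed_adj_linear using signed_adj_square[OF fin r that, of w] by (simp add: d_def)
    also have "\<dots> = d * u S"
      by (simp add: u_def algebra_simps power2_eq_square)
    finally show ?thesis .
  qed
  \<comment> \<open>Absolute values keep the norm, and the unsigned quadratic form of
    \<open>v\<close> dominates the signed one of \<open>u\<close>.\<close>
  define v where "v S = (if S \<in> Pow E then \<bar>u S\<bar> else 0)" for S
  have v_sq: "(v S)\<^sup>2 = u S * u S" if "S \<in> Pow E" for S
    using that by (simp add: v_def power2_eq_square)
  \<comment> \<open>At \<open>insert e R\<close> every toggle other than that of \<open>e\<close>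
    keeps \<open>e\<close> in the set, where \<open>w\<close> vanishes. So \<open>u\<close> equals
    \<open>w0 R\<close> up to sign there.\<close>
  have nz: "\<exists>S\<in>Pow E. u S \<noteq> 0"
  proof -
    obtain R where R: "R \<in> X" "w0 R \<noteq> 0"
      using w0 by blast
    then have eR: "e \<notin> R" and RE: "R \<subseteq> E"
      by (auto simp: X_def)
    have "w (toggle i (insert e R)) = (if i = e then w0 R else 0)" if "i \<in> E" for i
      using R eR by (auto simp: w_def X_def toggle_def)
    then have "signed_adj E r w (insert e R) = (\<Sum>i\<in>E. if i = e then toggle_sign r e (insert e R) * w0 R else 0)"
      unfolding signed_adj_def by (intro sum.cong refl) auto
    also have "\<dots> = toggle_sign r e (insert e R) * w0 R"
      using fin e by simp
    finally have "u (insert e R) = toggle_sign r e (insert e R) * w0 R"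
      by (simp add: u_def w_def X_def)
    then have "u (insert e R) \<noteq> 0"
      using R abs_toggle_sign[of r e "insert e R"] by auto
    then show ?thesis
      using e RE by (intro bexI[of _ "insert e R"]) auto
  qed
  show ?thesis
  proof (rule that[of v])
    show "v S \<ge> 0" for S
      by (simp add: v_def)
    show "v S = 0" if "S \<notin> H" for S
      using that w0(2) by (auto simp: v_def u_eq C_def)
    obtain S0 where "S0 \<in> Pow E" "u S0 \<noteq> 0"
      using nz by blast
    then have "0 < (v S0)\<^sup>2"
      by (simp add: v_def)
    then show "(\<Sum>S\<in>Pow E. (v S)\<^sup>2) > 0"
      using \<open>S0 \<in> Pow E\<close> fin by (intro sum_pos2[of _ S0]) auto
    have "d * (\<Sum>S\<in>Pow E. (v S)\<^sup>2) = (\<Sum>S\<in>Pow E. u S * signed_adj E r u S)"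
      unfolding sum_distrib_left by (intro sum.cong refl) (simp add: v_sq eigen)
    also have "\<dots> = (\<Sum>S\<in>Pow E. \<Sum>i\<in>E. u S * (toggle_sign r i S * u (toggle i S)))"
      by (simp add: signed_adj_def sum_distrib_left)
    also have "\<dots> \<le> (\<Sum>S\<in>Pow E. \<Sum>i\<in>E. v S * v (toggle i S))"
    proof (intro sum_mono)
      fix S i assume "S \<in> Pow E" "i \<in> E"
      then have "\<bar>u S * (toggle_sign r i S * u (toggle i S))\<bar> = v S * v (toggle i S)"
        by (simp add: v_def abs_mult abs_toggle_sign toggle_subset)
      then show "u S * (toggle_sign r i S * u (toggle i S)) \<le> v S * v (toggle i S)"
        by linarith
    qed
    finally show "sqrt (card E) * (\<Sum>S\<in>Pow E. (v S)\<^sup>2) \<le> (\<Sum>S\<in>Pow E. \<Sum>i\<in>E. v S * v (toggle i S))"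
      by (simp add: d_def)
  qed
qed

section \<open>Transitive functions on a power of two many variables\<close>

text \<open>Double counting of the pairs \<open>i \<in> S\<close>: by transitivity every
  \<open>i\<close> lies in equally many sets of the family, so the sum of their cardinalities is
  \<open>card E\<close> times that number.\<close>

lemma transitive_invariant_weight_class:
  assumes fin: "finite E"
    and trans: "\<And>i j. i \<in> E \<Longrightarrow> j \<in> E \<Longrightarrow> \<exists>\<pi>. bij_betw \<pi> E E \<and> \<pi> i = j \<and> (\<forall>S\<subseteq>E. g (\<pi> ` S) = g S)"
  shows "card E dvd w * card {S \<in> Pow E. g S \<and> card S = w}"
proof (cases "E = {}")
  case True
  then have "w = 0 \<or> {S \<in> Pow E. g S \<and> card S = w} = {}"
    by auto
  then show ?thesis
    by (metis card.empty dvd_0_right mult_zero_left mult_zero_right)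
next
  case False
  then obtain e where e: "e \<in> E"
    by blast
  define F where "F = {S \<in> Pow E. g S \<and> card S = w}"
  have finF: "finite F"
    using fin by (simp add: F_def)
  \<comment> \<open>One inequality suffices, as exchanging \<open>i\<close> and \<open>j\<close>
    gives the other.\<close>
  have le: "card {S \<in> F. i \<in> S} \<le> card {S \<in> F. j \<in> S}" if "i \<in> E" "j \<in> E" for i j
  proof -
    obtain \<pi> where \<pi>: "bij_betw \<pi> E E" "\<pi> i = j" "\<forall>S\<subseteq>E. g (\<pi> ` S) = g S"
      using trans[OF \<open>i \<in> E\<close> \<open>j \<in> E\<close>] by blast
    have inj: "inj_on \<pi> E" and im: "\<pi> ` E = E"
      using \<pi>(1) by (auto simp: bij_betw_def)
    show ?thesis
    proof (rule card_inj_on_le[where f = "(`) \<pi>"])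
      show "inj_on ((`) \<pi>) {S \<in> F. i \<in> S}"
        by (rule inj_on_subset[OF inj_on_image_Pow[OF inj]]) (auto simp: F_def)
      show "(`) \<pi> ` {S \<in> F. i \<in> S} \<subseteq> {S \<in> F. j \<in> S}"
      proof clarify
        fix S assume S: "S \<in> F" "i \<in> S"
        then have "S \<subseteq> E" "g S" "card S = w"
          by (auto simp: F_def)
        then have "\<pi> ` S \<subseteq> E" "g (\<pi> ` S)" "card (\<pi> ` S) = w"
          using \<pi>(3) im inj by (auto simp: card_image inj_on_subset)
        then show "\<pi> ` S \<in> F \<and> j \<in> \<pi> ` S"
          using S \<pi>(2) by (auto simp: F_def)
      qed
      show "finite {S \<in> F. j \<in> S}"
        using finF by simp
    qed
  qed
  have "w * card F = (\<Sum>S\<in>F. card S)"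
    by (simp add: F_def)
  also have "\<dots> = (\<Sum>S\<in>F. \<Sum>i\<in>E. if i \<in> S then 1 else 0)"
  proof (intro sum.cong refl)
    fix S assume "S \<in> F"
    then have "E \<inter> S = S"
      by (auto simp: F_def)
    then show "card S = (\<Sum>i\<in>E. if i \<in> S then 1 else 0)"
      using fin by (simp add: sum.If_cases)
  qed
  also have "\<dots> = (\<Sum>i\<in>E. \<Sum>S\<in>F. if i \<in> S then 1 else 0)"
    by (rule sum.swap)
  also have "\<dots> = (\<Sum>i\<in>E. card {S \<in> F. i \<in> S})"
    using finF by (simp add: sum.If_cases Int_def)
  also have "\<dots> = (\<Sum>i\<in>E. card {S \<in> F. e \<in> S})"
    by (intro sum.cong refl antisym le) (use e in auto)
  finally show ?thesis
    by (simp add: F_def)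
qed

text \<open>A weight class of odd size would force \<open>2 ^ k\<close> to divide its weight, so
  strictly intermediate weights contribute even numbers. Parity is decided by the empty set and
  \<open>E\<close>, exactly one of which satisfies \<open>g\<close>.\<close>

lemma transitive_invariant_odd:
  assumes fin: "finite E" and card: "card E = 2 ^ k"
    and trans: "\<And>i j. i \<in> E \<Longrightarrow> j \<in> E \<Longrightarrow> \<exists>\<pi>. bij_betw \<pi> E E \<and> \<pi> i = j \<and> (\<forall>S\<subseteq>E. g (\<pi> ` S) = g S)"
    and ends: "g {} \<noteq> g E"
  shows "odd (card {S \<in> Pow E. g S})"
proof -
  define F where "F w = {S \<in> Pow E. g S \<and> card S = w}" for w
  have finF: "finite (F w)" for w
    using fin by (simp add: F_def)
  have even_mid: "even (card (F w))" if "0 < w" "w < 2 ^ k" for w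
  proof (rule ccontr)
    assume "odd (card (F w))"
    then have "coprime (2 ^ k) (card (F w))"
      by simp
    moreover have "2 ^ k dvd w * card (F w)"
      using transitive_invariant_weight_class[OF fin trans, where w=w] card by (simp add: F_def)
    ultimately have "2 ^ k dvd w"
      by (simp add: coprime_dvd_mult_left_iff)
    then show False
      using that dvd_imp_le by fastforce
  qed
  have "card S = 0 \<longleftrightarrow> S = {}" if "S \<subseteq> E" for S
    using finite_subset[OF that fin] by simp
  then have "F 0 = (if g {} then {{}} else {})"
    by (auto simp: F_def)
  moreover have "F (2 ^ k) = (if g E then {E} else {})"
    using card_subset_eq[OF fin] by (auto simp: F_def simp flip: card)
  ultimately have ends': "odd (card (F 0) + card (F (2 ^ k)))"
    using ends by auto
  have "{S \<in> Pow E. g S} = (\<Union>w\<in>{..2 ^ k}. F w)"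
    using card card_mono[OF fin] by (auto simp: F_def)
  then have "card {S \<in> Pow E. g S} = (\<Sum>w\<in>{..2 ^ k}. card (F w))"
    using finF by (simp add: card_UN_disjoint F_def disjoint_iff)
  also have "{..2 ^ k :: nat} = insert 0 (insert (2 ^ k) {0<..<2 ^ k})"
    by (auto simp: le_less)
  also have "(\<Sum>w\<in>\<dots>. card (F w)) = card (F 0) + card (F (2 ^ k)) + (\<Sum>w\<in>{0<..<2 ^ k}. card (F w))"
    by simp
  also have "odd \<dots>"
  proof -
    have "even (\<Sum>w\<in>{0<..<2 ^ k}. card (F w))"
      by (intro dvd_sum even_mid) auto
    then show ?thesis
      using ends' by simp
  qed
  finally show ?thesis .
qed

text \<open>A toggle flips parity, so inside \<open>H c\<close> it must flip \<open>g\<close> as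
  well. The even and odd halves of the cube have equal size, which makes the sizes of
  \<open>H True\<close> and \<open>H False\<close> differ by twice the difference of
  \<open>P True True\<close> and \<open>P True False\<close>; this is nonzero because their sum is
  odd. In Fourier terms, the top coefficient of \<open>g\<close> does not vanish.\<close>

lemma odd_imp_large_sensitive_set:
  assumes fin: "finite E" and ne: "E \<noteq> {}" and odd: "odd (card {S \<in> Pow E. g S})"
  obtains H where "H \<subseteq> Pow E" "2 ^ card E < 2 * card H"
    "\<And>S i. S \<in> H \<Longrightarrow> i \<in> E \<Longrightarrow> toggle i S \<in> H \<Longrightarrow> g (toggle i S) \<noteq> g S"
proof -
  obtain e where e: "e \<in> E"
    using ne by blast
  have finS: "finite S" if "S \<subseteq> E" for S
    using fin that finite_subset by blast
  define H where "H c = {S \<in> Pow E. (g S \<longleftrightarrow> even (card S)) = c}" for c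
  define P where "P a b = {S \<in> Pow E. g S = a \<and> even (card S) = b}" for a b
  have finP: "finite (P a b)" for a b
    using fin by (simp add: P_def)
  have *: "card (P a b \<union> P a' b') = card (P a b) + card (P a' b')" if "(a, b) \<noteq> (a', b')" for a b a' b'
    using that finP by (intro card_Un_disjoint) (auto simp: P_def)
  have ev: "{S \<in> Pow E. even (card S)} = P True True \<union> P False True"
    and od: "{S \<in> Pow E. odd (card S)} = P True False \<union> P False False"
    and HT: "H True = P True True \<union> P False False"
    and HF: "H False = P True False \<union> P False True"
    and gS: "{S \<in> Pow E. g S} = P True True \<union> P True False"
    by (auto simp: P_def H_def)
  have "card {S \<in> Pow E. even (card S)} = card {S \<in> Pow E. odd (card S)}"
    by (rule bij_betw_same_card[of "toggle e"], rule bij_betw_byWitness[where f' = "toggle e"])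
      (use e finS in \<open>auto simp: even_card_toggle in_toggle_iff split: if_splits\<close>)
  then have "card (P True True) + card (P False True) = card (P True False) + card (P False False)"
    unfolding ev od by (simp add: *)
  moreover have "odd (card (P True True) + card (P True False))"
    using odd unfolding gS by (simp add: *)
  then have "card (P True True) \<noteq> card (P True False)"
    by fastforce
  ultimately have "card (H True) \<noteq> card (H False)"
    unfolding HT HF by (simp add: *)
  moreover have "card (H True) + card (H False) = 2 ^ card E"
  proof -
    have "Pow E = H True \<union> H False" "H True \<inter> H False = {}"
      by (auto simp: H_def)
    then show ?thesis
      using fin by (metis card_Pow card_Un_disjoint finite_Pow_iff finite_Un)
  qed
  ultimately obtain c where c: "2 ^ card E < 2 * card (H c)"
    by (metis (full_types) add_less_cancel_left add_less_cancel_right mult_2 nat_neq_iff)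
  show ?thesis
  proof (rule that[of "H c"])
    show "H c \<subseteq> Pow E"
      by (auto simp: H_def)
    show "g (toggle i S) \<noteq> g S" if "S \<in> H c" "i \<in> E" "toggle i S \<in> H c" for S i
      using that even_card_toggle[of S i] finS[of S] by (auto simp: H_def)
  qed (rule c)
qed

section \<open>The adversary method\<close>

text \<open>The real part suffices: it can be weighted and compared, unitaries preserve it, and on
  the diagonal it is the squared norm.\<close>

definition overlap :: "'b set \<Rightarrow> ('b \<Rightarrow> complex) \<Rightarrow> ('b \<Rightarrow> complex) \<Rightarrow> real" where
  "overlap B \<psi> \<phi> = Re (\<Sum>k\<in>B. cnj (\<psi> k) * \<phi> k)"

lemma overlap_self: "overlap B \<psi> \<psi> = (\<Sum>k\<in>B. (cmod (\<psi> k))\<^sup>2)"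
  unfolding overlap_def by (simp add: cmod_power2 flip: power2_eq_square)

lemma overlap_apply_mat:
  assumes fin: "finite B" and U: "unitary_on B U"
  shows "overlap B (apply_mat B U \<psi>) (apply_mat B U \<phi>) = overlap B \<psi> \<phi>"
proof -
  have "(\<Sum>k\<in>B. cnj (apply_mat B U \<psi> k) * apply_mat B U \<phi> k)
      = (\<Sum>k\<in>B. \<Sum>j\<in>B. \<Sum>j'\<in>B. cnj (\<psi> j) * \<phi> j' * (cnj (U k j) * U k j'))"
    by (intro sum.cong refl) (simp add: apply_mat_def sum_product, simp add: mult_ac)
  also have "\<dots> = (\<Sum>j\<in>B. \<Sum>j'\<in>B. \<Sum>k\<in>B. cnj (\<psi> j) * \<phi> j' * (cnj (U k j) * U k j'))"
    by (rule trans[OF sum.swap sum.cong[OF refl sum.swap]])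
  also have "\<dots> = (\<Sum>j\<in>B. \<Sum>j'\<in>B. cnj (\<psi> j) * \<phi> j' * (if j = j' then 1 else 0))"
    using U unfolding unitary_on_def by (intro sum.cong refl) (simp flip: sum_distrib_left)
  also have "\<dots> = (\<Sum>j\<in>B. cnj (\<psi> j) * \<phi> j)"
    using fin by (simp add: if_distrib cong: if_cong)
  finally show ?thesis
    by (simp add: overlap_def)
qed

section \<open>Decomposition of overlaps by the queried index\<close>

lemma finite_qbasis: "finite I \<Longrightarrow> finite (qbasis I W)"
  by (simp add: qbasis_def)

text \<open>The query magnitude: for a unit state and \<open>i\<close> in \<open>I\<close>, the
  probability of finding \<open>i\<close> in the query register.\<close>

definition query_mass :: "nat \<Rightarrow> 'i qstate \<Rightarrow> 'i \<Rightarrow> real" where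
  "query_mass W \<psi> i = (\<Sum>(b, w)\<in>UNIV \<times> {..<W}. (cmod (\<psi> (i, b, w)))\<^sup>2)"

definition query_overlap :: "nat \<Rightarrow> 'i qstate \<Rightarrow> 'i qstate \<Rightarrow> 'i \<Rightarrow> real" where
  "query_overlap W \<psi> \<phi> i = (\<Sum>(b, w)\<in>UNIV \<times> {..<W}. Re (cnj (\<psi> (i, b, w)) * \<phi> (i, b, w)))"

lemma overlap_qbasis: "overlap (qbasis I W) \<psi> \<phi> = (\<Sum>i\<in>I. query_overlap W \<psi> \<phi> i)"
  unfolding overlap_def query_overlap_def qbasis_def Re_sum
  by (simp add: sum.cartesian_product split_def)

lemma overlap_self_qbasis: "overlap (qbasis I W) \<psi> \<psi> = (\<Sum>i\<in>I. query_mass W \<psi> i)"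
  unfolding overlap_self query_mass_def qbasis_def
  by (simp add: sum.cartesian_product split_def)

lemma sum_xor_bool:
  "(\<Sum>(b :: bool, w)\<in>UNIV \<times> {..<W}. h (b \<noteq> (c :: bool)) w) = (\<Sum>(b, w)\<in>UNIV \<times> {..<W::nat}. h b w)"
  by (rule sum.reindex_bij_witness[where i = "\<lambda>(b, w). (b \<noteq> c, w)" and j = "\<lambda>(b, w). (b \<noteq> c, w)"]) auto

lemma query_overlap_query_op:
  assumes "x i = y i"
  shows "query_overlap W (query_op x \<psi>) (query_op y \<phi>) i = query_overlap W \<psi> \<phi> i"
  unfolding query_overlap_def
  using sum_xor_bool[of "\<lambda>b w. Re (cnj (\<psi> (i, b, w)) * \<phi> (i, b, w))" "y i" W] assms
  by (simp add: query_op_def)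

lemma query_mass_query_op: "query_mass W (query_op x \<psi>) i = query_mass W \<psi> i"
  unfolding query_mass_def
  using sum_xor_bool[of "\<lambda>b w. (cmod (\<psi> (i, b, w)))\<^sup>2" "x i" W]
  by (simp add: query_op_def)

text \<open>AM-GM in each term, with \<open>a\<close> attached to one state and \<open>b\<close> to
  the other. The masses end up in separate summands, so they can later be summed over all queried
  indices.\<close>

lemma abs_query_overlap_le:
  assumes "a \<ge> 0" "b \<ge> 0"
  shows "2 * (a * b * \<bar>query_overlap W \<psi> \<phi> i\<bar>) \<le> a\<^sup>2 * query_mass W \<psi> i + b\<^sup>2 * query_mass W \<phi> i"
proof -
  have "a * b * \<bar>query_overlap W \<psi> \<phi> i\<bar>
      \<le> a * b * (\<Sum>(c, w)\<in>UNIV \<times> {..<W}. cmod (\<psi> (i, c, w)) * cmod (\<phi> (i, c, w)))"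
    unfolding query_overlap_def
  proof (intro mult_left_mono order.trans[OF sum_abs] sum_mono)
    fix k :: "bool \<times> nat"
    obtain c w where k: "k = (c, w)"
      by fastforce
    have "\<bar>Re (cnj (\<psi> (i, c, w)) * \<phi> (i, c, w))\<bar> \<le> cmod (cnj (\<psi> (i, c, w)) * \<phi> (i, c, w))"
      by (rule abs_Re_le_cmod)
    then show "\<bar>case k of (c, w) \<Rightarrow> Re (cnj (\<psi> (i, c, w)) * \<phi> (i, c, w))\<bar>
        \<le> (case k of (c, w) \<Rightarrow> cmod (\<psi> (i, c, w)) * cmod (\<phi> (i, c, w)))"
      by (simp add: k norm_mult)
  qed (use assms in auto)
  moreover have "2 * (a * b * (\<Sum>(c, w)\<in>UNIV \<times> {..<W}. cmod (\<psi> (i, c, w)) * cmod (\<phi> (i, c, w))))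
      = (\<Sum>(c, w)\<in>UNIV \<times> {..<W}. 2 * (a * cmod (\<psi> (i, c, w))) * (b * cmod (\<phi> (i, c, w))))"
    by (simp add: sum_distrib_left split_def mult_ac)
  ultimately have "2 * (a * b * \<bar>query_overlap W \<psi> \<phi> i\<bar>)
      \<le> (\<Sum>(c, w)\<in>UNIV \<times> {..<W}. 2 * (a * cmod (\<psi> (i, c, w))) * (b * cmod (\<phi> (i, c, w))))"
    by linarith
  also have "\<dots> \<le> (\<Sum>(c, w)\<in>UNIV \<times> {..<W}. (a * cmod (\<psi> (i, c, w)))\<^sup>2 + (b * cmod (\<phi> (i, c, w)))\<^sup>2)"
    by (intro sum_mono) (auto simp only: split_def intro: sum_squares_bound)
  also have "\<dots> = a\<^sup>2 * query_mass W \<psi> i + b\<^sup>2 * query_mass W \<phi> i"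
    by (simp add: query_mass_def split_def power_mult_distrib sum.distrib sum_distrib_left)
  finally show ?thesis .
qed

lemma overlap_query_op_self:
  "overlap (qbasis I W) (query_op x \<psi>) (query_op x \<psi>) = overlap (qbasis I W) \<psi> \<psi>"
  by (simp add: overlap_self_qbasis query_mass_query_op)

text \<open>Where the inputs agree, a query permutes both states alike, so only block
  \<open>i\<close> can lose. Its loss is at most the sum of the absolute block overlaps before and
  after; each accounts for half of the bound, since queries preserve masses.\<close>

lemma overlap_query_op_drop:
  assumes "finite I" "i \<in> I" and xy: "\<And>j. j \<in> I \<Longrightarrow> j \<noteq> i \<Longrightarrow> x j = y j" and ab: "a \<ge> 0" "b \<ge> 0"
  shows "a * b * (overlap (qbasis I W) \<psi> \<phi> - overlap (qbasis I W) (query_op x \<psi>) (query_op y \<phi>))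
    \<le> a\<^sup>2 * query_mass W \<psi> i + b\<^sup>2 * query_mass W \<phi> i"
proof -
  let ?p = "query_overlap W \<psi> \<phi>" and ?q = "query_overlap W (query_op x \<psi>) (query_op y \<phi>)"
  have "(\<Sum>j\<in>I - {i}. ?q j) = (\<Sum>j\<in>I - {i}. ?p j)"
    by (intro sum.cong refl query_overlap_query_op xy) auto
  then have "overlap (qbasis I W) \<psi> \<phi> - overlap (qbasis I W) (query_op x \<psi>) (query_op y \<phi>) = ?p i - ?q i"
    using assms(1,2) by (simp add: overlap_qbasis sum.remove)
  moreover have "a * b * (?p i - ?q i) \<le> a * b * (\<bar>?p i\<bar> + \<bar>?q i\<bar>)"
    using ab by (intro mult_left_mono) auto
  moreover have "2 * (a * b * \<bar>?q i\<bar>) \<le> a\<^sup>2 * query_mass W \<psi> i + b\<^sup>2 * query_mass W \<phi> i"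
    using abs_query_overlap_le[OF ab, of W "query_op x \<psi>" "query_op y \<phi>" i]
    by (simp add: query_mass_query_op)
  moreover note abs_query_overlap_le[OF ab, of W \<psi> \<phi> i]
  ultimately show ?thesis
    by (simp add: distrib_left)
qed

text \<open>The adversary progress measure. Ordered pairs are summed, so each cube edge counts
  twice, as in the quadratic form of \<open>huang_eigenvector\<close>.\<close>

definition progress ::
    "'i set \<Rightarrow> ('i set \<Rightarrow> real) \<Rightarrow> 'i set \<Rightarrow> nat \<Rightarrow> ('i set \<Rightarrow> 'i qstate) \<Rightarrow> real" where
  "progress E v I W \<psi> =
    (\<Sum>S\<in>Pow E. \<Sum>i\<in>E. v S * v (toggle i S) * overlap (qbasis I W) (\<psi> S) (\<psi> (toggle i S)))"

text \<open>The masses of a unit state sum to at most 1, so each of the two endpoints of the cube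
  edges accounts for one copy of the squared norm of \<open>v\<close>. The bound does not grow with
  \<open>card E\<close>.\<close>

lemma progress_drop_query:
  fixes v :: "'i set \<Rightarrow> real"
  assumes fin: "finite I" "E \<subseteq> I" and v: "\<And>S. v S \<ge> 0"
    and x: "\<And>S i j. S \<subseteq> E \<Longrightarrow> i \<in> E \<Longrightarrow> j \<in> I \<Longrightarrow> j \<noteq> i \<Longrightarrow> x S j = x (toggle i S) j"
    and unit: "\<And>S. S \<subseteq> E \<Longrightarrow> overlap (qbasis I W) (\<psi> S) (\<psi> S) = 1"
  shows "progress E v I W \<psi> - progress E v I W (\<lambda>S. query_op (x S) (\<psi> S)) \<le> 2 * (\<Sum>S\<in>Pow E. (v S)\<^sup>2)"
proof -
  let ?m = "\<lambda>S i. (v S)\<^sup>2 * query_mass W (\<psi> S) i"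
  have finE: "finite E"
    using fin finite_subset by blast
  have mass: "(\<Sum>i\<in>E. query_mass W (\<psi> S) i) \<le> 1" if "S \<subseteq> E" for S
  proof -
    have "(\<Sum>i\<in>E. query_mass W (\<psi> S) i) \<le> (\<Sum>i\<in>I. query_mass W (\<psi> S) i)"
      using fin by (intro sum_mono2) (auto simp: query_mass_def intro!: sum_nonneg)
    then show ?thesis
      using unit[OF that] by (simp add: overlap_self_qbasis)
  qed
  have total: "(\<Sum>S\<in>Pow E. \<Sum>i\<in>E. ?m S i) \<le> (\<Sum>S\<in>Pow E. (v S)\<^sup>2)"
  proof (intro sum_mono)
    fix S assume "S \<in> Pow E"
    then have "(v S)\<^sup>2 * (\<Sum>i\<in>E. query_mass W (\<psi> S) i) \<le> (v S)\<^sup>2 * 1"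
      by (intro mult_left_mono mass) auto
    then show "(\<Sum>i\<in>E. ?m S i) \<le> (v S)\<^sup>2"
      by (simp add: sum_distrib_left)
  qed
  have "progress E v I W \<psi> - progress E v I W (\<lambda>S. query_op (x S) (\<psi> S))
     = (\<Sum>S\<in>Pow E. \<Sum>i\<in>E. v S * v (toggle i S) * (overlap (qbasis I W) (\<psi> S) (\<psi> (toggle i S))
        - overlap (qbasis I W) (query_op (x S) (\<psi> S)) (query_op (x (toggle i S)) (\<psi> (toggle i S)))))"
    by (simp add: progress_def sum_subtractf right_diff_distrib)
  also have "\<dots> \<le> (\<Sum>S\<in>Pow E. \<Sum>i\<in>E. ?m S i + ?m (toggle i S) i)"
    using fin v x by (intro sum_mono overlap_query_op_drop) auto
  also have "\<dots> = (\<Sum>S\<in>Pow E. \<Sum>i\<in>E. ?m S i) + (\<Sum>i\<in>E. \<Sum>S\<in>Pow E. ?m (toggle i S) i)"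
    by (simp add: sum.distrib) (rule sum.swap)
  also have "(\<Sum>i\<in>E. \<Sum>S\<in>Pow E. ?m (toggle i S) i) = (\<Sum>i\<in>E. \<Sum>S\<in>Pow E. ?m S i)"
    by (intro sum.cong refl sum_Pow_toggle)
  also have "\<dots> = (\<Sum>S\<in>Pow E. \<Sum>i\<in>E. ?m S i)"
    by (rule sum.swap)
  finally show ?thesis
    using total by linarith
qed

text \<open>Unitaries that do not depend on the input preserve every overlap, so only queries lower
  the progress.\<close>

lemma progress_drop_qrun:
  fixes v :: "'i set \<Rightarrow> real"
  assumes fin: "finite I" "E \<subseteq> I" and v: "\<And>S. v S \<ge> 0"
    and x: "\<And>S i j. S \<subseteq> E \<Longrightarrow> i \<in> E \<Longrightarrow> j \<in> I \<Longrightarrow> j \<noteq> i \<Longrightarrow> x S j = x (toggle i S) j"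
    and "\<And>S. S \<subseteq> E \<Longrightarrow> overlap (qbasis I W) (\<psi> S) (\<psi> S) = 1"
    and "\<forall>U\<in>set Us. unitary_on (qbasis I W) U"
  shows "progress E v I W \<psi> - progress E v I W (\<lambda>S. qrun (qbasis I W) (x S) (\<psi> S) Us)
    \<le> 2 * length Us * (\<Sum>S\<in>Pow E. (v S)\<^sup>2)"
  using assms(5,6)
proof (induction Us arbitrary: \<psi>)
  case (Cons U Us)
  let ?B = "qbasis I W"
  let ?\<psi> = "\<lambda>S. apply_mat ?B U (query_op (x S) (\<psi> S))"
  note U = overlap_apply_mat[OF finite_qbasis[OF fin(1)], of W U]
  have unit: "overlap ?B (?\<psi> S) (?\<psi> S) = 1" if "S \<subseteq> E" for S
    using U Cons.prems that by (simp add: overlap_query_op_self)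
  have "progress E v I W ?\<psi> = progress E v I W (\<lambda>S. query_op (x S) (\<psi> S))"
    unfolding progress_def using U Cons.prems by simp
  moreover have "progress E v I W \<psi> - progress E v I W (\<lambda>S. query_op (x S) (\<psi> S)) \<le> 2 * (\<Sum>S\<in>Pow E. (v S)\<^sup>2)"
    by (intro progress_drop_query fin v x Cons.prems(1))
  moreover have "progress E v I W ?\<psi> - progress E v I W (\<lambda>S. qrun ?B (x S) (?\<psi> S) Us)
      \<le> 2 * length Us * (\<Sum>S\<in>Pow E. (v S)\<^sup>2)"
    using Cons.prems(2) by (intro Cons.IH unit) auto
  ultimately show ?case
    by (simp add: algebra_simps)
qed simp

lemma overlap_qrun_self:
  assumes "finite I" "\<forall>U\<in>set Us. unitary_on (qbasis I W) U"
  shows "overlap (qbasis I W) (qrun (qbasis I W) x \<psi> Us) (qrun (qbasis I W) x \<psi> Us) = overlap (qbasis I W) \<psi> \<psi>"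
  using assms(2)
  by (induction Us arbitrary: \<psi>)
    (simp_all add: overlap_apply_mat[OF finite_qbasis[OF assms(1)]] overlap_query_op_self)

text \<open>Cauchy-Schwarz on both parts would give the sharp value \<open>2 * sqrt 2 / 3\<close>;
  fixed rational weights give the slightly larger 17/18 without square roots.\<close>

lemma overlap_distinguished:
  assumes fin: "finite B" and K: "K \<subseteq> B"
    and unit: "overlap B \<psi> \<psi> = 1" "overlap B \<phi> \<phi> = 1"
    and \<psi>: "(\<Sum>k\<in>K. (cmod (\<psi> k))\<^sup>2) \<ge> 2/3" and \<phi>: "(\<Sum>k\<in>B - K. (cmod (\<phi> k))\<^sup>2) \<ge> 2/3"
  shows "overlap B \<psi> \<phi> \<le> 17/18"
proof -
  define p where "p = (\<Sum>k\<in>K. (cmod (\<psi> k))\<^sup>2)"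
  define p' where "p' = (\<Sum>k\<in>B - K. (cmod (\<psi> k))\<^sup>2)"
  define q where "q = (\<Sum>k\<in>B - K. (cmod (\<phi> k))\<^sup>2)"
  define q' where "q' = (\<Sum>k\<in>K. (cmod (\<phi> k))\<^sup>2)"
  have pp: "p + p' = 1" and qq: "q + q' = 1"
    using unit sum.subset_diff[OF K fin, of "\<lambda>k. (cmod (\<psi> k))\<^sup>2"]
      sum.subset_diff[OF K fin, of "\<lambda>k. (cmod (\<phi> k))\<^sup>2"]
    by (simp_all add: p_def p'_def q_def q'_def overlap_self)
  have Re_le: "Re (cnj a * b) \<le> cmod a * cmod b" for a b
    using complex_Re_le_cmod[of "cnj a * b"] by (simp add: norm_mult)
  \<comment> \<open>AM-GM with weight 3/4, close to the optimal weight \<open>1 / sqrt 2\<close>\<close>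
  have amgm: "s * t \<le> 3/8 * s\<^sup>2 + 2/3 * t\<^sup>2" for s t :: real
    using zero_le_power2[of "3 * s - 4 * t"] by (simp add: power2_eq_square algebra_simps)
  have "overlap B \<psi> \<phi> = (\<Sum>k\<in>K. Re (cnj (\<psi> k) * \<phi> k)) + (\<Sum>k\<in>B - K. Re (cnj (\<psi> k) * \<phi> k))"
    using sum.subset_diff[OF K fin, of "\<lambda>k. Re (cnj (\<psi> k) * \<phi> k)"]
    by (simp only: overlap_def Re_sum)
  \<comment> \<open>On each part, 3/8 goes to the state concentrated there and 2/3 to the other. The
    total is \<open>4/3 - 7/24 * (p + q)\<close>, at most 17/18 because
    \<open>p + q \<ge> 4/3\<close>.\<close>
  also have "\<dots> \<le> (\<Sum>k\<in>K. 3/8 * (cmod (\<psi> k))\<^sup>2 + 2/3 * (cmod (\<phi> k))\<^sup>2)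
      + (\<Sum>k\<in>B - K. 3/8 * (cmod (\<phi> k))\<^sup>2 + 2/3 * (cmod (\<psi> k))\<^sup>2)"
    by (intro add_mono sum_mono; rule order.trans[OF Re_le])
      (rule amgm, subst mult.commute, rule amgm)
  also have "\<dots> = 3/8 * p + 2/3 * q' + (3/8 * q + 2/3 * p')"
    by (simp only: sum.distrib p_def p'_def q_def q'_def flip: sum_distrib_left)
  also have "\<dots> \<le> 17/18"
    using pp qq \<psi> \<phi> by (simp add: p_def[symmetric] q_def[symmetric])
  finally show ?thesis .
qed

text \<open>All runs start in the same state, so the progress begins at the full weight. Every pair
  of nonzero weight must be told apart, which leaves at most 17/18 of it, and \<open>T\<close>
  queries account for the missing 1/18.\<close>

lemma positive_adversary_bound:
  fixes v :: "'i set \<Rightarrow> real"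
  assumes fin: "finite I" "E \<subseteq> I" and v: "\<And>S. v S \<ge> 0"
    and alg: "computes_bounded_error I f T"
    and inp: "\<And>S. S \<subseteq> E \<Longrightarrow> x S \<in> I \<rightarrow>\<^sub>E UNIV"
    and x: "\<And>S i j. S \<subseteq> E \<Longrightarrow> i \<in> E \<Longrightarrow> j \<in> I \<Longrightarrow> j \<noteq> i \<Longrightarrow> x S j = x (toggle i S) j"
    and f: "\<And>S i. S \<subseteq> E \<Longrightarrow> i \<in> E \<Longrightarrow> v S * v (toggle i S) \<noteq> 0 \<Longrightarrow> f (x S) \<noteq> f (x (toggle i S))"
  shows "(\<Sum>S\<in>Pow E. \<Sum>i\<in>E. v S * v (toggle i S)) \<le> 36 * real T * (\<Sum>S\<in>Pow E. (v S)\<^sup>2)"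
proof -
  obtain W s0 U0 Us out where s0: "s0 \<in> qbasis I W" and U0: "unitary_on (qbasis I W) U0"
    and Us: "\<forall>U\<in>set Us. unitary_on (qbasis I W) U" and T: "length Us = T"
    and out: "\<And>x. x \<in> I \<rightarrow>\<^sub>E (UNIV :: bool set) \<Longrightarrow>
       (\<Sum>k\<in>{k \<in> qbasis I W. out k = f x}. (cmod (final_state (qbasis I W) x s0 U0 Us k))\<^sup>2) \<ge> 2/3"
    using alg unfolding computes_bounded_error_def by blast
  let ?B = "qbasis I W"
  let ?w = "\<lambda>S i. v S * v (toggle i S)"
  define \<psi>0 where "\<psi>0 = apply_mat ?B U0 (basis_vec s0)"
  define fin_st where "fin_st S = final_state ?B (x S) s0 U0 Us" for S
  have finB: "finite ?B"
    using fin finite_qbasis by blast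
  have "(cmod (basis_vec s0 k))\<^sup>2 = (if k = s0 then 1 else 0)" for k
    by (simp add: basis_vec_def)
  then have "overlap ?B (basis_vec s0) (basis_vec s0) = 1"
    using s0 finB by (simp add: overlap_self)
  then have unit0: "overlap ?B \<psi>0 \<psi>0 = 1"
    by (simp add: \<psi>0_def overlap_apply_mat[OF finB U0])
  have unit: "overlap ?B (fin_st S) (fin_st S) = 1" for S
    using overlap_qrun_self[OF fin(1) Us] unit0 by (simp add: fin_st_def final_state_def \<psi>0_def)
  have start: "progress E v I W (\<lambda>_. \<psi>0) = (\<Sum>S\<in>Pow E. \<Sum>i\<in>E. ?w S i)"
    by (simp add: progress_def unit0)
  have "progress E v I W fin_st \<le> (\<Sum>S\<in>Pow E. \<Sum>i\<in>E. ?w S i * (17/18))"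
    unfolding progress_def
  proof (intro sum_mono)
    fix S i assume S: "S \<in> Pow E" and i: "i \<in> E"
    show "?w S i * overlap ?B (fin_st S) (fin_st (toggle i S)) \<le> ?w S i * (17/18)"
    proof (cases "?w S i = 0")
      case True
      then show ?thesis
        by (simp only: mult_zero_left)
    next
      case False
      let ?K = "{k \<in> ?B. out k = f (x S)}"
      have S': "toggle i S \<subseteq> E"
        using S i by (simp add: toggle_subset)
      have "f (x S) \<noteq> f (x (toggle i S))"
        using f[of S i] S i False by simp
      then have "{k \<in> ?B. out k = f (x (toggle i S))} = ?B - ?K"
        by auto
      then have "overlap ?B (fin_st S) (fin_st (toggle i S)) \<le> 17/18"
        using out[OF inp[of S]] out[OF inp[OF S']] S
        by (intro overlap_distinguished[where K = ?K] finB unit) (auto simp: fin_st_def)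
      then show ?thesis
        using v by (intro mult_left_mono) auto
    qed
  qed
  also have "\<dots> = 17/18 * (\<Sum>S\<in>Pow E. \<Sum>i\<in>E. ?w S i)"
    by (subst mult.commute) (simp only: sum_distrib_right)
  finally have fin_le: "progress E v I W fin_st \<le> 17/18 * (\<Sum>S\<in>Pow E. \<Sum>i\<in>E. ?w S i)" .
  have "progress E v I W (\<lambda>_. \<psi>0) - progress E v I W (\<lambda>S. qrun ?B (x S) \<psi>0 Us)
    \<le> 2 * length Us * (\<Sum>S\<in>Pow E. (v S)\<^sup>2)"
    by (intro progress_drop_qrun fin v x unit0 Us)
  then have "progress E v I W (\<lambda>_. \<psi>0) - progress E v I W fin_st \<le> 2 * T * (\<Sum>S\<in>Pow E. (v S)\<^sup>2)"
    by (simp add: fin_st_def[abs_def] final_state_def \<psi>0_def T)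
  with start fin_le show ?thesis
    by simp
qed

section \<open>Existence of an exact algorithm\<close>

text \<open>Serves to complete a reversible step prescribed on part of the basis to a permutation,
  hence to a unitary.\<close>

lemma inj_on_extends_to_bij_betw:
  assumes fin: "finite B" and "A \<subseteq> B" "inj_on h A" "h ` A \<subseteq> B"
  obtains p where "bij_betw p B B" "\<And>a. a \<in> A \<Longrightarrow> p a = h a"
proof -
  have "card (B - A) = card (B - h ` A)"
    using assms by (simp add: card_Diff_subset finite_subset card_image)
  then obtain q where q: "bij_betw q (B - A) (B - h ` A)"
    using fin finite_same_card_bij[of "B - A" "B - h ` A"] by auto
  let ?p = "\<lambda>a. if a \<in> A then h a else q a"
  have "bij_betw ?p A (h ` A)"
    using assms by (simp add: bij_betw_def inj_on_def)
  moreover have "bij_betw ?p (B - A) (B - h ` A)"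
    using q by (subst bij_betw_cong[of _ _ q]) auto
  ultimately have "bij_betw ?p (A \<union> (B - A)) (h ` A \<union> (B - h ` A))"
    by (rule bij_betw_combine) auto
  then have "bij_betw ?p B B"
    using assms by (simp add: Un_absorb1)
  then show ?thesis
    by (rule that) simp
qed

definition perm_mat :: "('i \<times> bool \<times> nat \<Rightarrow> 'i \<times> bool \<times> nat) \<Rightarrow> 'i qmat" where
  "perm_mat p k j = (if k = p j then 1 else 0)"

lemma unitary_on_perm_mat:
  assumes "finite B" "bij_betw p B B"
  shows "unitary_on B (perm_mat p)"
  unfolding unitary_on_def
proof (intro ballI)
  fix j j' assume j: "j \<in> B" "j' \<in> B"
  then have p: "p j \<in> B" "p j = p j' \<longleftrightarrow> j = j'"
    using assms(2) by (auto simp: bij_betw_def inj_on_def)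
  have "(\<Sum>k\<in>B. cnj (perm_mat p k j) * perm_mat p k j') = (\<Sum>k\<in>B. if k = p j then (if j = j' then 1 else 0) else 0)"
    using p(2) by (intro sum.cong refl) (auto simp: perm_mat_def)
  also have "\<dots> = (if j = j' then 1 else 0)"
    using assms(1) p(1) by simp
  finally show "(\<Sum>k\<in>B. cnj (perm_mat p k j) * perm_mat p k j') = (if j = j' then 1 else 0)" .
qed

lemma apply_perm_mat_basis_vec:
  assumes "finite B" "p s \<in> B" "s \<in> B"
  shows "apply_mat B (perm_mat p) (basis_vec s) = basis_vec (p s)"
proof
  fix k
  have "(\<Sum>j\<in>B. perm_mat p k j * basis_vec s j) = (\<Sum>j\<in>B. if j = s then perm_mat p k s else 0)"
    by (intro sum.cong refl) (auto simp: basis_vec_def)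
  then show "apply_mat B (perm_mat p) (basis_vec s) k = basis_vec (p s) k"
    using assms by (auto simp: apply_mat_def perm_mat_def basis_vec_def)
qed

lemma query_op_basis_vec: "query_op x (basis_vec (i, b, w)) = basis_vec (i, b \<noteq> x i, w)"
  by (auto simp: query_op_def basis_vec_def fun_eq_iff)

text \<open>\<open>Q\<close> is a \<open>LEAST\<close>, hence unspecified unless some algorithm exists.\<close>
lemma exists_exact_algorithm:
  assumes fin: "finite I" and i0: "i0 \<in> I"
  shows "\<exists>T. computes_bounded_error I f T"
proof -
  define W where "W = card (Pow I)"
  obtain enc where enc: "bij_betw enc (Pow I) {..<W}"
    using ex_bij_betw_finite_nat[of "Pow I"] fin by (auto simp: W_def atLeast0LessThan)
  have enc_lt: "enc S < W" if "S \<subseteq> I" for S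
    using enc that by (auto simp: bij_betw_def)
  have enc_inj: "enc S = enc S' \<longleftrightarrow> S = S'" if "S \<subseteq> I" "S' \<subseteq> I" for S S'
    using enc that by (auto simp: bij_betw_def inj_on_def)
  let ?B = "qbasis I W"
  have finB: "finite ?B"
    using fin by (simp add: qbasis_def)
  have inB: "(i, b, enc S) \<in> ?B" if "i \<in> I" "S \<subseteq> I" for i b S
    using that enc_lt by (simp add: qbasis_def)
  \<comment> \<open>After the query at \<open>i\<close>, the answer bit is absorbed into the record
    and reset, and the register moves on to \<open>j\<close>. This is injective because
    \<open>i\<close> is not yet in \<open>S\<close>: its later membership reveals the bit.\<close>
  have step: "\<exists>U. unitary_on ?B U \<and> (\<forall>x. \<forall>S\<subseteq>I - {i}. apply_mat ?B U (query_op x (basis_vec (i, False, enc S)))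
      = basis_vec (j, False, enc (if x i then insert i S else S)))" if ij: "i \<in> I" "j \<in> I" for i j
  proof -
    define A where "A = (\<lambda>(b, S). (i, b, enc S)) ` ((UNIV :: bool set) \<times> Pow (I - {i}))"
    define h where "h = (\<lambda>(i' :: 'a, b, w). (j, False,
        enc (if b then insert i (inv_into (Pow I) enc w) else inv_into (Pow I) enc w)))"
    have dec: "inv_into (Pow I) enc (enc S) = S" if "S \<subseteq> I" for S
      using enc that by (simp add: bij_betw_def)
    have h: "h (i, b, enc S) = (j, False, enc (if b then insert i S else S))" if "S \<subseteq> I - {i}" for b S
      using dec[OF subset_trans[OF that Diff_subset]] by (simp add: h_def)
    have "inj_on h A"
    proof (rule inj_onI)
      fix a a' assume "a \<in> A" "a' \<in> A" and eq: "h a = h a'"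
      then obtain b S b' S' where a: "a = (i, b, enc S)" "S \<subseteq> I - {i}"
        and a': "a' = (i, b', enc S')" "S' \<subseteq> I - {i}"
        by (auto simp: A_def)
      let ?R = "if b then insert i S else S" and ?R' = "if b' then insert i S' else S'"
      have "?R \<subseteq> I" "?R' \<subseteq> I"
        using a a' ij by auto
      then have "?R = ?R'"
        using eq a a' enc_inj by (simp add: h)
      moreover have "i \<notin> S" "i \<notin> S'"
        using a a' by auto
      ultimately have "b = b'" "S = S'"
        by (auto split: if_splits)
      then show "a = a'"
        by (simp add: a a')
    qed
    moreover have "A \<subseteq> ?B"
      using ij inB by (auto simp: A_def)
    moreover have "h ` A \<subseteq> ?B"
    proof
      fix y assume "y \<in> h ` A"
      then obtain b S where S: "S \<subseteq> I - {i}" and y: "y = h (i, b, enc S)"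
        by (auto simp: A_def)
      have "(if b then insert i S else S) \<subseteq> I"
        using S ij by auto
      then show "y \<in> ?B"
        unfolding y h[OF S] using ij by (intro inB)
    qed
    ultimately obtain p where p: "bij_betw p ?B ?B" "\<And>a. a \<in> A \<Longrightarrow> p a = h a"
      using inj_on_extends_to_bij_betw[OF finB] by metis
    have "apply_mat ?B (perm_mat p) (query_op x (basis_vec (i, False, enc S)))
      = basis_vec (j, False, enc (if x i then insert i S else S))" if S: "S \<subseteq> I - {i}" for x S
    proof -
      let ?s = "(i, x i, enc S)"
      have s: "?s \<in> A" "?s \<in> ?B"
        using S ij inB[of i S] by (auto simp: A_def)
      then have "p ?s \<in> ?B"
        using p(1) bij_betwE by blast
      then have "apply_mat ?B (perm_mat p) (basis_vec ?s) = basis_vec (p ?s)"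
        using apply_perm_mat_basis_vec finB s by blast
      then show ?thesis
        using p(2)[OF s(1)] h[OF S] by (simp add: query_op_basis_vec)
    qed
    then show ?thesis
      using unitary_on_perm_mat[OF finB p(1)] by blast
  qed
  \<comment> \<open>The register has to point at an index before that index is queried;
    \<open>i0\<close> is a dummy position once the list is exhausted.\<close>
  define first where "first es = (case es of [] \<Rightarrow> i0 | i # _ \<Rightarrow> i)" for es
  have run: "\<exists>Us. (\<forall>U\<in>set Us. unitary_on ?B U) \<and>
      (\<forall>x. \<forall>S\<subseteq>I - set es. qrun ?B x (basis_vec (first es, False, enc S)) Us
         = basis_vec (i0, False, enc (S \<union> {i \<in> set es. x i})))"
    if "distinct es" "set es \<subseteq> I" for es
    using that
  proof (induction es)
    case Nil
    show ?case
      by (intro exI[of _ "[]"]) (simp add: first_def)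
  next
    case (Cons i es)
    then obtain Us where Us: "\<forall>U\<in>set Us. unitary_on ?B U"
      and run: "\<And>x S. S \<subseteq> I - set es \<Longrightarrow> qrun ?B x (basis_vec (first es, False, enc S)) Us
         = basis_vec (i0, False, enc (S \<union> {i \<in> set es. x i}))"
      by auto
    have "i \<in> I" "first es \<in> I"
      using Cons.prems i0 by (auto simp: first_def split: list.split)
    then obtain U where U: "unitary_on ?B U"
      and U_step: "\<And>x S. S \<subseteq> I - {i} \<Longrightarrow> apply_mat ?B U (query_op x (basis_vec (i, False, enc S)))
      = basis_vec (first es, False, enc (if x i then insert i S else S))"
      using step by meson
    have "qrun ?B x (basis_vec (first (i # es), False, enc S)) (U # Us)
         = basis_vec (i0, False, enc (S \<union> {k \<in> set (i # es). x k}))" if S: "S \<subseteq> I - set (i # es)" for x S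
    proof -
      let ?R = "if x i then insert i S else S"
      have "S \<subseteq> I - {i}" "?R \<subseteq> I - set es"
        using S Cons.prems by auto
      moreover have "?R \<union> {k \<in> set es. x k} = S \<union> {k \<in> set (i # es). x k}"
        by auto
      ultimately show ?thesis
        using run[of ?R x] U_step[of S x] by (simp add: first_def)
    qed
    then show ?case
      using U Us by (intro exI[of _ "U # Us"]) auto
  qed
  obtain es where es: "set es = I" "distinct es"
    using fin finite_distinct_list by blast
  obtain Us where Us: "\<forall>U\<in>set Us. unitary_on ?B U"
    and Us_run: "\<forall>x. \<forall>S\<subseteq>I - set es. qrun ?B x (basis_vec (first es, False, enc S)) Us
         = basis_vec (i0, False, enc (S \<union> {i \<in> set es. x i}))"
    using run[OF es(2)] es(1) by blast
  have final: "qrun ?B x (basis_vec (first es, False, enc {})) Us = basis_vec (i0, False, enc {i \<in> I. x i})" for x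
    using Us_run[rule_format, of "{}" x] es(1) by simp
  have "first es \<in> I"
    using es i0 by (auto simp: first_def split: list.split)
  then have s0: "(first es, False, enc {}) \<in> ?B"
    by (simp add: inB)
  define out where "out k = f (restrict (\<lambda>i. i \<in> inv_into (Pow I) enc (snd (snd k))) I)" for k :: "'a \<times> bool \<times> nat"
  have "computes_bounded_error I f (length Us)"
    unfolding computes_bounded_error_def
  proof (intro exI conjI ballI)
    show "(first es, False, enc {}) \<in> ?B"
      by (rule s0)
    show "unitary_on ?B (perm_mat id)"
      using unitary_on_perm_mat[OF finB] by simp
    show "unitary_on ?B U" if "U \<in> set Us" for U
      using Us that by blast
    fix x assume x: "x \<in> I \<rightarrow>\<^sub>E (UNIV :: bool set)"
    let ?X = "{i \<in> I. x i}"
    let ?s = "(i0, False, enc ?X)"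
    have "restrict (\<lambda>i. i \<in> ?X) I = x"
      using x by (auto simp: restrict_def PiE_def extensional_def fun_eq_iff)
    moreover have "inv_into (Pow I) enc (enc ?X) = ?X"
      using enc by (simp add: bij_betw_def)
    ultimately have "out ?s = f x"
      by (simp add: out_def)
    moreover have "?s \<in> ?B"
      using i0 by (intro inB) auto
    ultimately have mem: "?s \<in> {k \<in> ?B. out k = f x}"
      by simp
    have "final_state ?B x (first es, False, enc {}) (perm_mat id) Us = basis_vec ?s"
      using s0 by (simp add: final_state_def apply_perm_mat_basis_vec[OF finB] final)
    moreover have "(\<Sum>k\<in>{k \<in> ?B. out k = f x}. (cmod (basis_vec ?s k))\<^sup>2)
        = (\<Sum>k\<in>{k \<in> ?B. out k = f x}. if k = ?s then 1 else 0)"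
      by (intro sum.cong refl) (simp add: basis_vec_def)
    moreover have "\<dots> = 1"
      using mem finB by (subst sum.delta) auto
    ultimately show "2 / 3 \<le> (\<Sum>k\<in>{k \<in> ?B. out k = f x}.
        (cmod (final_state ?B x (first es, False, enc {}) (perm_mat id) Us k))\<^sup>2)"
      by simp
  qed simp
  then show ?thesis ..
qed

section \<open>Transitive restrictions of monotone graph properties\<close>

unbundle bit_operations_syntax

section \<open>Cliques and complete bipartite graphs under vertex maps\<close>

definition clique :: "'a set \<Rightarrow> 'a set set" where
  "clique V = {e. e \<subseteq> V \<and> card e = 2}"

definition cross :: "'a set \<Rightarrow> 'a set \<Rightarrow> 'a set set" where
  "cross A B = {{a, b} |a b. a \<in> A \<and> b \<in> B}"

lemma graph_edges_eq_clique: "graph_edges n = clique {..<n}"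
  by (simp add: graph_edges_def clique_def)

lemma in_clique_iff: "e \<in> clique V \<longleftrightarrow> (\<exists>a\<in>V. \<exists>b\<in>V. a \<noteq> b \<and> e = {a, b})"
  by (auto simp: clique_def card_2_iff)

lemma clique_mono: "V \<subseteq> V' \<Longrightarrow> clique V \<subseteq> clique V'"
  by (auto simp: clique_def)

lemma clique_remove: "v \<in> V \<Longrightarrow> clique V = cross {v} (V - {v}) \<union> clique (V - {v})"
  by (fastforce simp: in_clique_iff cross_def)

lemma cross_subset_clique: "A \<inter> B = {} \<Longrightarrow> A \<subseteq> V \<Longrightarrow> B \<subseteq> V \<Longrightarrow> cross A B \<subseteq> clique V"
  by (fastforce simp: in_clique_iff cross_def)

lemma image_clique:
  assumes "inj \<pi>"
  shows "(`) \<pi> ` clique V = clique (\<pi> ` V)"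
proof
  show "(`) \<pi> ` clique V \<subseteq> clique (\<pi> ` V)"
    using assms by (auto simp: clique_def card_image inj_on_subset)
  show "clique (\<pi> ` V) \<subseteq> (`) \<pi> ` clique V"
  proof
    fix e assume "e \<in> clique (\<pi> ` V)"
    then obtain a b where "a \<in> V" "b \<in> V" "a \<noteq> b" "e = \<pi> ` {a, b}"
      by (auto simp: in_clique_iff)
    then show "e \<in> (`) \<pi> ` clique V"
      by (metis imageI in_clique_iff)
  qed
qed

lemma image_cross: "(`) \<pi> ` cross A B = cross (\<pi> ` A) (\<pi> ` B)"
proof
  show "(`) \<pi> ` cross A B \<subseteq> cross (\<pi> ` A) (\<pi> ` B)"
    by (auto simp: cross_def)
  show "cross (\<pi> ` A) (\<pi> ` B) \<subseteq> (`) \<pi> ` cross A B"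
  proof
    fix e assume "e \<in> cross (\<pi> ` A) (\<pi> ` B)"
    then obtain a b where "a \<in> A" "b \<in> B" "e = \<pi> ` {a, b}"
      by (auto simp: cross_def)
    moreover from this have "{a, b} \<in> cross A B"
      by (auto simp: cross_def)
    ultimately show "e \<in> (`) \<pi> ` cross A B"
      by blast
  qed
qed

lemma card_cross:
  assumes "A \<inter> B = {}"
  shows "card (cross A B) = card A * card B"
proof -
  have "cross A B = (\<lambda>(a, b). {a, b}) ` (A \<times> B)"
    by (auto simp: cross_def)
  moreover have "inj_on (\<lambda>(a, b). {a, b}) (A \<times> B)"
    using assms by (auto simp: inj_on_def doubleton_eq_iff)
  ultimately show ?thesis
    by (simp add: card_image card_cartesian_product)
qed

lemma involution_image_eq:
  assumes "\<And>x. \<pi> (\<pi> x) = x" "\<pi> ` A \<subseteq> A"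
  shows "\<pi> ` A = A"
  using assms by (metis image_subset_iff subsetI subset_antisym image_eqI)

text \<open>Edges in \<open>G\<close> are forced present, those of \<open>cross A B\<close> are
  free, all others are absent. Since \<open>a\<close> and \<open>b\<close> can be moved
  independently, the symmetries of the restriction act transitively on the free edges.\<close>

definition bipartite_core :: "nat \<Rightarrow> (nat set set \<Rightarrow> bool) \<Rightarrow> nat \<Rightarrow> bool" where
  "bipartite_core n F m \<longleftrightarrow> (\<exists>A B G. A \<subseteq> {..<n} \<and> B \<subseteq> {..<n} \<and> A \<inter> B = {} \<and> card A = m \<and> card B = m \<and>
     G \<subseteq> graph_edges n \<and> \<not> F G \<and> F (G \<union> cross A B) \<and>
     (\<forall>a\<in>A. \<forall>a'\<in>A. \<forall>b\<in>B. \<forall>b'\<in>B. \<exists>\<pi>. \<pi> permutes {..<n} \<and> \<pi> ` A = A \<and> \<pi> ` B = B \<and>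
        (`) \<pi> ` G = G \<and> \<pi> a = a' \<and> \<pi> b = b'))"

lemma nat_xor_less_power: "x < 2 ^ N \<Longrightarrow> y < 2 ^ N \<Longrightarrow> x XOR y < (2 ^ N :: nat)"
  by (metis take_bit_nat_eq_self_iff take_bit_xor)

text \<open>XOR with \<open>2 ^ j\<close> exchanges the numbers with bit \<open>j\<close> set and
  those with bit \<open>j\<close> clear.\<close>

lemma card_bit_half:
  assumes "j \<le> k"
  shows "card {x \<in> {..<2 ^ Suc k :: nat}. bit x j = c} = 2 ^ k"
proof -
  let ?X = "\<lambda>c. {x \<in> {..<2 ^ Suc k :: nat}. bit x j = c}"
  have "(2 :: nat) ^ j < 2 ^ Suc k"
    using assms by (intro power_strict_increasing) auto
  then have lt: "x XOR 2 ^ j < 2 ^ Suc k" if "x < 2 ^ Suc k" for x :: nat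
    using that by (intro nat_xor_less_power)
  have flip: "bit (x XOR 2 ^ j) j \<longleftrightarrow> \<not> bit x j" for x :: nat
    by (simp add: bit_xor_iff bit_exp_iff)
  have "card (?X True) = card (?X False)"
    by (rule bij_betw_same_card[of "\<lambda>x. x XOR 2 ^ j"],
        rule bij_betw_byWitness[where f' = "\<lambda>x. x XOR 2 ^ j"])
      (use lt flip in \<open>auto simp: xor.assoc simp del: power_Suc\<close>)
  moreover have "?X True \<union> ?X False = {..<2 ^ Suc k}"
    by auto
  then have "card (?X True) + card (?X False) = 2 * 2 ^ k"
    by (subst card_Un_disjoint[symmetric]) (auto simp: disjoint_iff)
  ultimately show ?thesis
    by (cases c) auto
qed

text \<open>With edge sets in place of inputs, forcing edges to be present is a plain union.\<close>

locale monotone_graph_property =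
  fixes n :: nat and F :: "nat set set \<Rightarrow> bool"
  assumes mono: "G \<subseteq> G' \<Longrightarrow> G' \<subseteq> graph_edges n \<Longrightarrow> F G \<Longrightarrow> F G'"
    and inv: "\<pi> permutes {..<n} \<Longrightarrow> G \<subseteq> graph_edges n \<Longrightarrow> F ((`) \<pi> ` G) = F G"
begin

text \<open>Besides \<open>G\<close>, make all of \<open>V - A\<close> a clique. This avoids a
  vertex of \<open>A\<close>, so \<open>F\<close> fails by \<open>lo\<close>; adding
  \<open>cross A B\<close> joins a vertex of \<open>B\<close> to all of \<open>V\<close>, so
  \<open>F\<close> holds by \<open>hi\<close>. Spare vertices stay in the clique, and swaps within
  \<open>A\<close> and within \<open>B\<close> are symmetries.\<close>

lemma bipartite_core_threshold:
  assumes V: "V \<subseteq> {..<n}" "2 * m \<le> card V" "m > 0"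
    and G: "G \<subseteq> graph_edges n" "\<And>\<pi>. \<pi> permutes V \<Longrightarrow> (`) \<pi> ` G = G"
    and lo: "\<And>v. v \<in> V \<Longrightarrow> \<not> F (G \<union> clique (V - {v}))"
    and hi: "\<And>v. v \<in> V \<Longrightarrow> F (G \<union> cross {v} (V - {v}))"
  shows "bipartite_core n F m"
proof -
  have finV: "finite V"
    using V finite_subset by blast
  obtain A where A: "A \<subseteq> V" "card A = m"
    using V(2) by (metis le_trans le_add1 mult_2 obtain_subset_with_card_n)
  have "m \<le> card (V - A)"
    using V A finV by (simp add: card_Diff_subset finite_subset)
  then obtain B where B: "B \<subseteq> V - A" "card B = m"
    by (meson obtain_subset_with_card_n)
  define G' where "G' = G \<union> clique (V - A)"
  have sub: "clique V \<subseteq> graph_edges n" "cross A B \<subseteq> clique V" "clique (V - A) \<subseteq> clique V"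
    unfolding graph_edges_eq_clique using V A B
    by (intro clique_mono cross_subset_clique; auto)+
  obtain a0 where a0: "a0 \<in> A"
    using A V by fastforce
  obtain b0 where b0: "b0 \<in> B"
    using B V by fastforce
  have "G' \<subseteq> G \<union> clique (V - {a0})" "G \<union> clique (V - {a0}) \<subseteq> graph_edges n"
    using a0 G sub clique_mono[of "V - A" "V - {a0}"] clique_mono[of "V - {a0}" V] by (auto simp: G'_def)
  then have "\<not> F G'"
    using mono lo a0 A by blast
  have "cross {b0} (V - {b0}) \<subseteq> clique (V - A) \<union> cross A B"
  proof
    fix e assume "e \<in> cross {b0} (V - {b0})"
    then obtain v where v: "e = {b0, v}" "v \<in> V" "v \<noteq> b0"
      by (auto simp: cross_def)
    show "e \<in> clique (V - A) \<union> cross A B"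
    proof (cases "v \<in> A")
      case True
      then have "e \<in> cross A B"
        using v b0 by (auto simp: cross_def)
      then show ?thesis ..
    next
      case False
      then have "e \<in> clique (V - A)"
        using v b0 B by (fastforce simp: in_clique_iff)
      then show ?thesis ..
    qed
  qed
  then have "F (G' \<union> cross A B)"
    using hi[of b0] b0 B G sub
    by (intro mono[of "G \<union> cross {b0} (V - {b0})" "G' \<union> cross A B"]) (auto simp: G'_def)
  have "\<exists>\<pi>. \<pi> permutes {..<n} \<and> \<pi> ` A = A \<and> \<pi> ` B = B \<and> (`) \<pi> ` G' = G' \<and> \<pi> a = a' \<and> \<pi> b = b'"
    if "a \<in> A" "a' \<in> A" "b \<in> B" "b' \<in> B" for a a' b b'
  proof -
    define \<pi> where "\<pi> = transpose a a' \<circ> transpose b b'"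
    have out: "b \<notin> A" "b' \<notin> A" "a \<notin> B" "a' \<notin> B" "a \<in> V" "a' \<in> V" "b \<in> V" "b' \<in> V"
      using that A B by auto
    have perm: "\<pi> permutes V"
      unfolding \<pi>_def using out by (intro permutes_compose permutes_swap_id)
    have A': "\<pi> ` A = A" and B': "\<pi> ` B = B"
      unfolding \<pi>_def image_comp[symmetric] using out that by simp_all
    have "\<pi> ` (V - A) = V - A"
      using A' permutes_image[OF perm] permutes_inj[OF perm] by (simp add: image_set_diff)
    then have "(`) \<pi> ` G' = G'"
      using G(2)[OF perm] image_clique[OF permutes_inj[OF perm], of "V - A"] by (simp add: G'_def image_Un)
    moreover have "\<pi> a = a'" "\<pi> b = b'"
      using out that by (auto simp: \<pi>_def transpose_def)
    ultimately show ?thesis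
      using A' B' permutes_subset[OF perm V(1)] by blast
  qed
  then show ?thesis
    unfolding bipartite_core_def
    using \<open>\<not> F G'\<close> \<open>F (G' \<union> cross A B)\<close> A B V G sub
    by (intro exI[of _ A] exI[of _ B] exI[of _ G']) (auto simp: G'_def)
qed

text \<open>Identifying \<open>V\<close> with \<open>{..<2 ^ Suc k}\<close>, the graphs joining numbers congruent modulo \<open>2 ^ j\<close>
  decrease from the clique (\<open>j = 0\<close>) to the empty graph (\<open>j = Suc k\<close>). At the step where \<open>F\<close> changes,
  split \<open>V\<close> by the value of bit \<open>j\<close>; XOR with constants acts transitively on each half.\<close>
lemma bipartite_core_power_of_two:
  assumes V: "V \<subseteq> {..<n}" "card V = 2 ^ Suc k"
    and G: "G \<subseteq> graph_edges n" "\<And>\<pi>. \<pi> permutes V \<Longrightarrow> (`) \<pi> ` G = G"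
    and lo: "\<not> F G" and hi: "F (G \<union> clique V)"
  shows "bipartite_core n F (2 ^ k)"
proof -
  define X where "X = {..<2 ^ Suc k :: nat}"
  have finV: "finite V"
    using V finite_subset by blast
  obtain h where h: "bij_betw h X V"
    using ex_bij_betw_nat_finite[OF finV] V(2) by (auto simp: X_def atLeast0LessThan)
  have hV: "h x \<in> V" if "x \<in> X" for x
    using h that bij_betwE by blast
  have h_inj: "h x = h y \<longleftrightarrow> x = y" if "x \<in> X" "y \<in> X" for x y
    using h that by (meson bij_betw_def inj_on_eq_iff)
  define H where "H j = {{h x, h y} |x y. x \<in> X \<and> y \<in> X \<and> x \<noteq> y \<and> take_bit j x = take_bit j y}" for j
  have H0: "H 0 = clique V"
  proof
    show "H 0 \<subseteq> clique V"
      unfolding H_def in_clique_iff subset_iff using hV h_inj by blast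
    show "clique V \<subseteq> H 0"
    proof
      fix e assume "e \<in> clique V"
      then obtain a b where ab: "a \<in> V" "b \<in> V" "a \<noteq> b" "e = {a, b}"
        by (auto simp: in_clique_iff)
      moreover obtain x y where "x \<in> X" "y \<in> X" "a = h x" "b = h y"
        using ab h by (metis bij_betw_imp_surj_on imageE)
      ultimately show "e \<in> H 0"
        by (auto simp: H_def)
    qed
  qed
  have HN: "H (Suc k) = {}"
    by (auto simp: H_def X_def take_bit_nat_eq_self simp del: power_Suc)
  have HV: "H j \<subseteq> clique V" for j
    unfolding H0[symmetric] by (auto simp: H_def)
  have VE: "clique V \<subseteq> graph_edges n"
    using V clique_mono by (simp add: graph_edges_eq_clique)
  obtain l where l: "l \<le> Suc k" "\<forall>i<l. F (G \<union> H i)" "\<not> F (G \<union> H l)"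
    using ex_least_nat_le[of "\<lambda>i. \<not> F (G \<union> H i)" "Suc k"] lo HN by auto
  have "l \<noteq> 0"
    using l hi H0 by metis
  then obtain j where "l = Suc j"
    using not0_implies_Suc by blast
  then have j: "j \<le> k" "F (G \<union> H j)" "\<not> F (G \<union> H (Suc j))"
    using l by auto
  define A where "A = h ` {x \<in> X. bit x j = False}"
  define B where "B = h ` {x \<in> X. bit x j = True}"
  define G' where "G' = G \<union> H (Suc j)"
  have AB: "A \<subseteq> V" "B \<subseteq> V" "A \<inter> B = {}"
    using hV h_inj by (auto simp: A_def B_def)
  have h_inj_on: "inj_on h Y" if "Y \<subseteq> X" for Y
    using h that by (meson bij_betw_def inj_on_subset)
  have "card A = 2 ^ k"
    using card_bit_half[OF j(1), of False] h_inj_on[of "{x \<in> X. bit x j = False}"]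
    unfolding A_def by (subst card_image) (auto simp: X_def)
  moreover have "card B = 2 ^ k"
    using card_bit_half[OF j(1), of True] h_inj_on[of "{x \<in> X. bit x j = True}"]
    unfolding B_def by (subst card_image) (auto simp: X_def)
  \<comment> \<open>Numbers congruent modulo \<open>2 ^ j\<close> agree in bit \<open>j\<close> or
    lie in different halves. \<open>cross A B\<close> may also contain edges outside
    \<open>H j\<close>; monotonicity absorbs them.\<close>
  moreover have "H j \<subseteq> H (Suc j) \<union> cross A B"
  proof
    fix e assume "e \<in> H j"
    then obtain x y where xy: "e = {h x, h y}" "x \<in> X" "y \<in> X" "x \<noteq> y" "take_bit j x = take_bit j y"
      by (auto simp: H_def)
    show "e \<in> H (Suc j) \<union> cross A B"
    proof (cases "bit x j = bit y j")
      case True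
      then have "take_bit (Suc j) x = take_bit (Suc j) y"
        using xy(5) by (simp only: take_bit_Suc_from_most)
      then have "e \<in> H (Suc j)"
        using xy by (auto simp: H_def)
      then show ?thesis ..
    next
      case False
      then have "e \<in> cross A B"
        using xy by (cases "bit x j") (auto simp: cross_def A_def B_def)
      then show ?thesis ..
    qed
  qed
  moreover have crossV: "cross A B \<subseteq> clique V"
    using AB cross_subset_clique by blast
  ultimately have "F (G' \<union> cross A B)"
    using j(2) G(1) HV[of "Suc j"] VE
    by (intro mono[of "G \<union> H j" "G' \<union> cross A B"]) (auto simp: G'_def)
  have "\<exists>\<pi>. \<pi> permutes {..<n} \<and> \<pi> ` A = A \<and> \<pi> ` B = B \<and> (`) \<pi> ` G' = G' \<and> \<pi> a = a' \<and> \<pi> b = b'"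
    if ab: "a \<in> A" "a' \<in> A" "b \<in> B" "b' \<in> B" for a a' b b'
  proof -
    obtain s0 s1 where s: "a = h s0" "a' = h s1" "s0 \<in> X" "s1 \<in> X" "\<not> bit s0 j" "\<not> bit s1 j"
      using ab by (auto simp: A_def)
    obtain t0 t1 where t: "b = h t0" "b' = h t1" "t0 \<in> X" "t1 \<in> X" "bit t0 j" "bit t1 j"
      using ab by (auto simp: B_def)
    \<comment> \<open>Both XOR constants have bit \<open>j\<close> clear, so the halves are
      preserved. Numbers congruent modulo \<open>2 ^ Suc j\<close> share bit \<open>j\<close> and
      receive the same constant, so \<open>H (Suc j)\<close> is preserved too.\<close>
    define \<sigma> where "\<sigma> x = x XOR (if bit x j then t0 XOR t1 else s0 XOR s1)" for x
    have \<sigma>_bit: "bit (\<sigma> x) j = bit x j" for x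
      using s t by (simp add: \<sigma>_def bit_xor_iff)
    have \<sigma>_inv: "\<sigma> (\<sigma> x) = x" for x
      using \<sigma>_bit[of x] by (simp add: \<sigma>_def[of "\<sigma> x"]) (simp add: \<sigma>_def xor.assoc)
    have \<sigma>_X: "\<sigma> x \<in> X" if "x \<in> X" for x
      using that s t unfolding \<sigma>_def X_def by (auto simp del: power_Suc intro!: nat_xor_less_power)
    have \<sigma>_take: "take_bit (Suc j) (\<sigma> x) = take_bit (Suc j) (\<sigma> y)"
      if "take_bit (Suc j) x = take_bit (Suc j) y" for x y
    proof -
      have "bit x j = bit y j"
        using that by (metis bit_take_bit_iff lessI)
      then show ?thesis
        using that by (simp add: \<sigma>_def take_bit_xor)
    qed
    define \<pi> where "\<pi> v = (if v \<in> V then h (\<sigma> (inv_into X h v)) else v)" for v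
    have \<pi>_h: "\<pi> (h x) = h (\<sigma> x)" if "x \<in> X" for x
      using that h hV by (simp add: \<pi>_def bij_betw_def)
    have \<pi>_inv: "\<pi> (\<pi> v) = v" for v
    proof (cases "v \<in> V")
      case True
      then obtain x where "x \<in> X" "v = h x"
        using h by (metis bij_betw_imp_surj_on imageE)
      then show ?thesis
        by (simp add: \<pi>_h \<sigma>_X \<sigma>_inv)
    qed (simp add: \<pi>_def)
    have \<pi>_V: "\<pi> v \<in> V" if "v \<in> V" for v
      using that h \<sigma>_X hV by (metis \<pi>_h bij_betw_imp_surj_on imageE)
    have perm: "\<pi> permutes V"
    proof (rule bij_imp_permutes)
      show "bij_betw \<pi> V V"
        by (rule bij_betw_byWitness[where f' = \<pi>]) (use \<pi>_inv \<pi>_V in auto)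
    qed (simp add: \<pi>_def)
    have "\<pi> ` A = A" "\<pi> ` B = B"
      by (rule involution_image_eq[OF \<pi>_inv]; auto simp: A_def B_def \<pi>_h \<sigma>_X \<sigma>_bit)+
    moreover have "(`) \<pi> ` H (Suc j) = H (Suc j)"
    proof (rule involution_image_eq)
      show "\<pi> ` \<pi> ` e = e" for e
        by (simp add: image_image \<pi>_inv)
      show "(`) \<pi> ` H (Suc j) \<subseteq> H (Suc j)"
      proof clarify
        fix e assume "e \<in> H (Suc j)"
        then obtain x y where xy: "e = {h x, h y}" "x \<in> X" "y \<in> X" "x \<noteq> y"
          "take_bit (Suc j) x = take_bit (Suc j) y"
          by (auto simp: H_def)
        then have "\<pi> ` e = {h (\<sigma> x), h (\<sigma> y)}" "\<sigma> x \<noteq> \<sigma> y"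
          using \<sigma>_inv by (auto simp: \<pi>_h) metis
        then show "\<pi> ` e \<in> H (Suc j)"
          using xy \<sigma>_X \<sigma>_take unfolding H_def by blast
      qed
    qed
    then have "(`) \<pi> ` G' = G'"
      using G(2)[OF perm] by (simp add: G'_def image_Un)
    moreover have "\<pi> a = a'" "\<pi> b = b'"
      using s t by (simp_all add: \<pi>_h \<sigma>_def flip: xor.assoc)
    ultimately show ?thesis
      using permutes_subset[OF perm V(1)] by blast
  qed
  moreover have "G' \<subseteq> graph_edges n"
    using G(1) HV[of "Suc j"] VE by (auto simp: G'_def)
  ultimately show ?thesis
    unfolding bipartite_core_def
    using j(3) \<open>F (G' \<union> cross A B)\<close> AB V(1) \<open>card A = 2 ^ k\<close> \<open>card B = 2 ^ k\<close>
    by (intro exI[of _ A] exI[of _ B] exI[of _ G']) (auto simp: G'_def)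
qed

text \<open>As long as \<open>V\<close> is too large, isolate a vertex or join it to all others if this keeps \<open>F\<close>
  nonconstant on the rest; otherwise \<open>bipartite_core_threshold\<close> applies.\<close>
lemma bipartite_core_exists_aux:
  assumes "V \<subseteq> {..<n}" "2 ^ Suc k \<le> card V"
    and "G \<subseteq> graph_edges n" "\<And>\<pi>. \<pi> permutes V \<Longrightarrow> (`) \<pi> ` G = G"
    and "\<not> F G" "F (G \<union> clique V)"
  shows "bipartite_core n F (2 ^ k)"
  using assms
proof (induction "card V" arbitrary: V G rule: less_induct)
  case less
  note V = less.prems(1,2) and G = less.prems(3,4)
  have finV: "finite V"
    using V finite_subset by blast
  show ?case
  proof (cases "card V = 2 ^ Suc k")
    case True
    then show ?thesis
      using bipartite_core_power_of_two less.prems by blast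
  next
    case False
    then have big: "2 ^ Suc k \<le> card (V - {v})" "card (V - {v}) < card V" if "v \<in> V" for v
      using V finV that by (auto simp: card_Diff_singleton card_gt_0_iff)
    have perm: "\<pi> permutes V" if "\<pi> permutes V - {v}" for \<pi> v
      using that permutes_subset by blast
    \<comment> \<open>Isolating \<open>v\<close> keeps the lower end \<open>G\<close>; joining it to
      the rest keeps the upper end \<open>G \<union> clique V\<close>. Only the other end has to be
      tested, and failure of both tests for all \<open>v\<close> is the threshold situation.\<close>
    consider v where "v \<in> V" "F (G \<union> clique (V - {v}))"
      | v where "v \<in> V" "\<not> F (G \<union> cross {v} (V - {v}))"
      | "\<And>v. v \<in> V \<Longrightarrow> \<not> F (G \<union> clique (V - {v}))" "\<And>v. v \<in> V \<Longrightarrow> F (G \<union> cross {v} (V - {v}))"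
      by blast
    then show ?thesis
    proof cases
      case (1 v)
      show ?thesis
        by (rule less.hyps[of "V - {v}" G]) (use 1 big perm less.prems in auto)
    next
      case (2 v)
      let ?G = "G \<union> cross {v} (V - {v})"
      have "clique V \<subseteq> graph_edges n"
        using V clique_mono by (simp add: graph_edges_eq_clique)
      then have sub: "?G \<subseteq> graph_edges n"
        using G 2 clique_remove[of v V] by blast
      have inv': "(`) \<pi> ` ?G = ?G" if \<pi>: "\<pi> permutes V - {v}" for \<pi>
      proof -
        have "\<pi> ` {v} = {v}" "\<pi> ` (V - {v}) = V - {v}"
          using permutes_not_in[OF \<pi>] permutes_image[OF \<pi>] by auto
        then show ?thesis
          using G(2)[OF perm[OF \<pi>]] by (simp add: image_Un image_cross)
      qed
      have "F (?G \<union> clique (V - {v}))"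
        using less.prems(6) clique_remove[OF 2(1)] by (simp add: Un_assoc)
      then show ?thesis
        using less.hyps[of "V - {v}" ?G] 2 big sub inv' V by blast
    next
      case 3
      show ?thesis
        by (rule bipartite_core_threshold[OF V(1) _ _ G 3]) (use V(2) in auto)
    qed
  qed
qed

lemma bipartite_core_exists:
  assumes "2 ^ Suc k \<le> n" "\<not> F {}" "F (graph_edges n)"
  shows "bipartite_core n F (2 ^ k)"
  using assms by (intro bipartite_core_exists_aux[of "{..<n}" k "{}"]) (auto simp: graph_edges_eq_clique)

end

section \<open>The lower bound\<close>

text \<open>\<open>x\<close> embeds the cube over \<open>E\<close> into the inputs. Huang's vector
  bounds the same quadratic form from below that the adversary method bounds from above, and its
  positive squared norm cancels.\<close>

lemma transitive_subcube_query_bound: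
  fixes E :: "'i set"
  assumes fin: "finite I" "E \<subseteq> I" and card: "card E = 2 ^ k"
    and alg: "computes_bounded_error I f T"
    and inp: "\<And>S. S \<subseteq> E \<Longrightarrow> x S \<in> I \<rightarrow>\<^sub>E UNIV"
    and x: "\<And>S i j. S \<subseteq> E \<Longrightarrow> i \<in> E \<Longrightarrow> j \<in> I \<Longrightarrow> j \<noteq> i \<Longrightarrow> x S j = x (toggle i S) j"
    and trans: "\<And>i j. i \<in> E \<Longrightarrow> j \<in> E \<Longrightarrow>
      \<exists>\<pi>. bij_betw \<pi> E E \<and> \<pi> i = j \<and> (\<forall>S\<subseteq>E. f (x (\<pi> ` S)) = f (x S))"
    and ends: "f (x {}) \<noteq> f (x E)"
  shows "sqrt (card E) \<le> 36 * real T"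
proof -
  have finE: "finite E"
    using fin finite_subset by blast
  have ne: "E \<noteq> {}"
    using card by auto
  have "odd (card {S \<in> Pow E. f (x S)})"
    by (rule transitive_invariant_odd[OF finE card trans ends])
  then obtain H where H: "H \<subseteq> Pow E" "2 ^ card E < 2 * card H"
    "\<And>S i. S \<in> H \<Longrightarrow> i \<in> E \<Longrightarrow> toggle i S \<in> H \<Longrightarrow> f (x (toggle i S)) \<noteq> f (x S)"
    using odd_imp_large_sensitive_set[OF finE ne, of "\<lambda>S. f (x S)"] by metis
  obtain v :: "'i set \<Rightarrow> real" where v: "\<And>S. v S \<ge> 0" "\<And>S. S \<notin> H \<Longrightarrow> v S = 0" "(\<Sum>S\<in>Pow E. (v S)\<^sup>2) > 0"
    "sqrt (card E) * (\<Sum>S\<in>Pow E. (v S)\<^sup>2) \<le> (\<Sum>S\<in>Pow E. \<Sum>i\<in>E. v S * v (toggle i S))"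
    using huang_eigenvector[OF finE ne H(1,2)] by blast
  have sens: "f (x S) \<noteq> f (x (toggle i S))" if "i \<in> E" "v S * v (toggle i S) \<noteq> 0" for S i
  proof -
    have "S \<in> H" "toggle i S \<in> H"
      using that v(2) by (metis mult_zero_left, metis mult_zero_right)
    then show ?thesis
      using H(3) that(1) by metis
  qed
  have "(\<Sum>S\<in>Pow E. \<Sum>i\<in>E. v S * v (toggle i S)) \<le> 36 * real T * (\<Sum>S\<in>Pow E. (v S)\<^sup>2)"
    by (intro positive_adversary_bound[where I = I and f = f and x = x] fin v(1) alg inp x sens)
  with v(4) have "sqrt (card E) * (\<Sum>S\<in>Pow E. (v S)\<^sup>2) \<le> 36 * real T * (\<Sum>S\<in>Pow E. (v S)\<^sup>2)"
    by linarith
  then show ?thesis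
    using v(3) by (simp add: mult_le_cancel_right)
qed

section \<open>Translation between edge sets and inputs\<close>

definition graph_input :: "nat \<Rightarrow> nat set set \<Rightarrow> nat set \<Rightarrow> bool" where
  "graph_input n G = restrict (\<lambda>e. e \<in> G) (graph_edges n)"

lemma graph_input_in_inputs: "graph_input n G \<in> graph_inputs n"
  by (simp add: graph_input_def)

lemma graph_input_Collect:
  "x \<in> graph_inputs n \<Longrightarrow> graph_input n {e \<in> graph_edges n. x e} = x"
  by (auto simp: graph_input_def restrict_def PiE_def extensional_def fun_eq_iff)

lemma finite_graph_edges: "finite (graph_edges n)"
  by (rule finite_subset[of _ "Pow {..<n}"]) (auto simp: graph_edges_def)

text \<open>\<open>is_graph_property\<close> pulls an input back along \<open>\<pi>\<close>, whereas
  the locale pushes an edge set forward; composing the two returns the original graph.\<close>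

lemma monotone_graph_property_graph_input:
  assumes f: "is_graph_property n f" "monotone_on_inputs n f"
  shows "monotone_graph_property n (\<lambda>G. f (graph_input n G))"
proof
  fix G G' assume "G \<subseteq> G'" "G' \<subseteq> graph_edges n" "f (graph_input n G)"
  then show "f (graph_input n G')"
    using f(2) graph_input_in_inputs unfolding monotone_on_inputs_def
    by (elim ballE[of _ _ "graph_input n G"] ballE[of _ _ "graph_input n G'"])
      (auto simp: graph_input_def)
next
  fix \<pi> G assume \<pi>: "\<pi> permutes {..<n}" and G: "G \<subseteq> graph_edges n"
  have inj: "inj \<pi>"
    using \<pi> by (rule permutes_inj)
  have im: "\<pi> ` e \<in> graph_edges n" if "e \<in> graph_edges n" for e
    using image_clique[OF inj, of "{..<n}"] permutes_image[OF \<pi>] that by (auto simp: graph_edges_eq_clique)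
  have "\<pi> ` e \<in> (`) \<pi> ` G \<longleftrightarrow> e \<in> G" for e
    using inj by (simp add: inj_image_mem_iff inj_image_eq_iff image_iff)
  then have "restrict (\<lambda>e. graph_input n ((`) \<pi> ` G) (\<pi> ` e)) (graph_edges n) = graph_input n G"
    using im by (auto simp: graph_input_def restrict_def)
  then show "f (graph_input n ((`) \<pi> ` G)) = f (graph_input n G)"
    using f(1) \<pi> graph_input_in_inputs unfolding is_graph_property_def by metis
qed

lemma graph_property_query_bound:
  assumes f: "is_graph_property n f" "monotone_on_inputs n f" "nontrivial_on_inputs n f"
    and k: "2 ^ Suc k \<le> n" and alg: "computes_bounded_error (graph_edges n) f T"
  shows "2 ^ k \<le> 36 * real T"
proof -
  let ?I = "graph_edges n"
  let ?F = "\<lambda>G. f (graph_input n G)"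
  interpret monotone_graph_property n ?F
    using f by (intro monotone_graph_property_graph_input)
  obtain x y where xy: "x \<in> graph_inputs n" "y \<in> graph_inputs n" "f x" "\<not> f y"
    using f(3) unfolding nontrivial_on_inputs_def by blast
  have "?F {e \<in> ?I. x e}" "\<not> ?F {e \<in> ?I. y e}"
    using xy by (simp_all add: graph_input_Collect)
  then have hi: "?F ?I" and lo: "\<not> ?F {}"
    using mono[of "{e \<in> ?I. x e}" ?I] mono[of "{}" "{e \<in> ?I. y e}"] by auto
  obtain A B G where AB: "A \<subseteq> {..<n}" "B \<subseteq> {..<n}" "A \<inter> B = {}" "card A = 2 ^ k" "card B = 2 ^ k"
    and G: "G \<subseteq> ?I" "\<not> ?F G" "?F (G \<union> cross A B)"
    and trans: "\<forall>a\<in>A. \<forall>a'\<in>A. \<forall>b\<in>B. \<forall>b'\<in>B.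
      \<exists>\<pi>. \<pi> permutes {..<n} \<and> \<pi> ` A = A \<and> \<pi> ` B = B \<and> (`) \<pi> ` G = G \<and> \<pi> a = a' \<and> \<pi> b = b'"
    using bipartite_core_exists[OF k lo hi] unfolding bipartite_core_def by (elim exE conjE) (rule that)
  let ?E = "cross A B"
  have EI: "?E \<subseteq> ?I"
    using AB cross_subset_clique by (simp add: graph_edges_eq_clique)
  \<comment> \<open>The exponent is even, so the square root is exactly
    \<open>2 ^ k\<close>.\<close>
  have cardE: "card ?E = 2 ^ (2 * k)"
    using AB by (simp add: card_cross mult_2 power_add)
  have "sqrt (card ?E) \<le> 36 * real T"
  proof (rule transitive_subcube_query_bound[OF finite_graph_edges EI cardE alg])
    show "graph_input n (G \<union> S) \<in> ?I \<rightarrow>\<^sub>E UNIV" for S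
      by (rule graph_input_in_inputs)
    show "graph_input n (G \<union> S) j = graph_input n (G \<union> toggle i S) j" if "j \<noteq> i" for S i j
      using that by (auto simp: graph_input_def toggle_def)
    show "?F (G \<union> {}) \<noteq> ?F (G \<union> ?E)"
      using G by simp
    fix i j assume "i \<in> ?E" "j \<in> ?E"
    then obtain a b a' b' where ab: "i = {a, b}" "j = {a', b'}" "a \<in> A" "a' \<in> A" "b \<in> B" "b' \<in> B"
      by (auto simp: cross_def)
    then obtain \<pi> where \<pi>: "\<pi> permutes {..<n}" "\<pi> ` A = A" "\<pi> ` B = B" "(`) \<pi> ` G = G" "\<pi> a = a'" "\<pi> b = b'"
      using trans[rule_format, of a a' b b'] by blast
    have "inj_on ((`) \<pi>) ?E"
      using permutes_inj[OF \<pi>(1)] by (simp add: inj_on_def inj_image_eq_iff)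
    then have "bij_betw ((`) \<pi>) ?E ?E"
      using \<pi>(2,3) by (simp add: bij_betw_def image_cross)
    moreover have "?F (G \<union> (`) \<pi> ` S) = ?F (G \<union> S)" if "S \<subseteq> ?E" for S
      using inv[OF \<pi>(1), of "G \<union> S"] that G(1) EI \<pi>(4) by (simp add: image_Un)
    ultimately show "\<exists>\<pi>. bij_betw \<pi> ?E ?E \<and> \<pi> i = j \<and> (\<forall>S\<subseteq>?E. ?F (G \<union> \<pi> ` S) = ?F (G \<union> S))"
      using ab \<pi>(5,6) by (intro exI[of _ "(`) \<pi>"]) auto
  qed
  moreover have "real (card ?E) = (2 ^ k)\<^sup>2"
    by (simp add: cardE mult.commute flip: power_mult)
  ultimately show ?thesis
    by simp
qed

theorem theorem1p5:
  shows "\<exists>c::real. c > 0 \<and>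
    (\<forall>n::nat. \<forall>f :: (nat set \<Rightarrow> bool) \<Rightarrow> bool.
       is_graph_property n f \<and> monotone_on_inputs n f \<and> nontrivial_on_inputs n f \<longrightarrow>
       real (Q (graph_edges n) f) \<ge> c * real n)"
proof (intro exI[of _ "1 / 144"] conjI allI impI)
  fix n and f :: "(nat set \<Rightarrow> bool) \<Rightarrow> bool"
  assume f: "is_graph_property n f \<and> monotone_on_inputs n f \<and> nontrivial_on_inputs n f"
  obtain x y where xy: "x \<in> graph_inputs n" "y \<in> graph_inputs n" "f x \<noteq> f y"
    using f unfolding nontrivial_on_inputs_def by blast
  \<comment> \<open>Without edges there would be a single extensional input and \<open>f\<close>
    could not take two values.\<close>
  have "graph_edges n \<noteq> {}"
    using xy by auto
  then obtain e where e: "e \<in> graph_edges n"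
    by blast
  then have "card e \<le> n"
    unfolding graph_edges_def by (metis (mono_tags) card_lessThan card_mono finite_lessThan mem_Collect_eq)
  then have n: "2 \<le> n"
    using e by (simp add: graph_edges_def)
  have "computes_bounded_error (graph_edges n) f (Q (graph_edges n) f)"
    unfolding Q_def using exists_exact_algorithm[OF finite_graph_edges e] by (rule LeastI_ex)
  moreover obtain l where l: "2 ^ l \<le> n" "n < 2 ^ (l + 1)"
    using ex_power_ivl1[of 2 n] n by auto
  \<comment> \<open>\<open>n \<ge> 2\<close> gives \<open>l \<ge> 1\<close>; one factor of two is
    spent on having two disjoint sides.\<close>
  moreover obtain k where k: "l = Suc k"
    using l n by (cases l) auto
  ultimately have "2 ^ k \<le> 36 * real (Q (graph_edges n) f)"
    using f by (intro graph_property_query_bound) auto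
  \<comment> \<open>The factor \<open>4 = 144 / 36\<close> comes from
    \<open>l + 1 = k + 2\<close>.\<close>
  moreover have "real n < real (4 * 2 ^ k)"
    using l(2) k by (simp only: of_nat_less_iff) simp
  ultimately show "1 / 144 * real n \<le> real (Q (graph_edges n) f)"
    by simp
qed simp

end
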